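(* Let $E$ be a graph and $K$ a field. The Leavitt path algebra $L_K(E)$ is simple if and only if $E$ satisfies the following two conditions: (i) the only saturated hereditary subsets of $E^0$ are $\emptyset$ and $E^0$; and (ii) the graph $E$ satisfies Condition (L).
   Context: Algebras are not assumed commutative or unital, and ideals are two-sided. A graph $E=(E^0,E^1,r,s)$ is a directed graph with countable vertex set $E^0$, countable edge set $E^1$, and range and source maps $r,s:E^1\to E^0$ (no row-finiteness is assumed). A vertex $v$ is regular ($v\in E^0_{\mathrm{reg}}$) if $0<|s^{-1}(v)|<\infty$. $L_K(E)$ is the universal $K$-algebra generated by pairwise orthogonal idempotents $\{v:v\in E^0\}$ and elements $\{e,e^*:e\in E^1\}$ satisfying (1) $s(e)e=er(e)=e$; (2) $r(e)e^*=e^*s(e)=e^*$; (3) $e^*f=\delta_{e,f}r(e)$ for all $e,f\in E^1$; (4) $v=\sum_{s(e)=v}ee^*$ for all $v\in E^0_{\mathrm{reg}}$. Simple means that the only ideals are $\{0\}$ and the whole algebra. A subset $H\subseteq E^0$ is hereditary if $s(e)\in H$ implies $r(e)\in H$ for all $e\in E^1$. A hereditary set $H$ is saturated if whenever $0<|s^{-1}(v)|<\infty$ and $\{r(e):e\in E^1,s(e)=v\}\subseteq H$, then $v\in H$. A closed path is a path $\alpha=e_1\cdots e_n$ ($n\ge1$, $r(e_i)=s(e_{i+1})$) with $r(e_n)=s(e_1)$. An edge $f$ is an exit for $\alpha$ if for some $i$ one has $s(f)=s(e_i)$ but $f\neq e_i$. $E$ satisfies Condition (L) if every closed path in $E$ has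 an exit. *)

theory Defs
  imports
    "HOL-Library.Countable_Set"
    "HOL-Library.Poly_Mapping"
    "Graph_Theory.Arc_Walk"
begin

section \<open>Directed graphs\<close>

text \<open>
  A graph $(E^0,E^1,r,s)$ is a \<^locale>\<open>wf_digraph\<close> with \<^const>\<open>verts\<close> $= E^0$,
  \<^const>\<open>arcs\<close> $= E^1$, \<^const>\<open>tail\<close> $= s$ and \<^const>\<open>head\<close> $= r$.
\<close>

definition regular_vertex :: "('v, 'e) pre_digraph \<Rightarrow> 'v \<Rightarrow> bool" where
  "regular_vertex E v \<longleftrightarrow> v \<in> verts E \<and> finite (out_arcs E v) \<and> out_arcs E v \<noteq> {}"

definition hereditary :: "('v, 'e) pre_digraph \<Rightarrow> 'v set \<Rightarrow> bool" where
  "hereditary E H \<longleftrightarrow> H \<subseteq> verts E \<and> (\<forall>e \<in> arcs E. tail E e \<in> H \<longrightarrow> head E e \<in> H)"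

definition saturated :: "('v, 'e) pre_digraph \<Rightarrow> 'v set \<Rightarrow> bool" where
  "saturated E H \<longleftrightarrow>
     (\<forall>v. regular_vertex E v \<and> head E ` out_arcs E v \<subseteq> H \<longrightarrow> v \<in> H)"

definition is_exit :: "('v, 'e) pre_digraph \<Rightarrow> 'e list \<Rightarrow> 'e \<Rightarrow> bool" where
  "is_exit E p f \<longleftrightarrow>
     f \<in> arcs E \<and> (\<exists>i < length p. tail E f = tail E (p ! i) \<and> f \<noteq> p ! i)"

definition condition_L :: "('v, 'e) pre_digraph \<Rightarrow> bool" where
  "condition_L E \<longleftrightarrow> (\<forall>p. wf_digraph.closed_w E p \<longrightarrow> (\<exists>f. is_exit E p f))"


section \<open>Algebras, ideals, quotients\<close>

text \<open>
  Algebras over a field, neither commutative nor unital in general. (The ring structures of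
  HOL-Algebra carry a unit, so they do not apply.)
\<close>

record ('k, 'a) algebra =
  Carrier :: "'a set"
  Zero :: "'a"
  Add :: "'a \<Rightarrow> 'a \<Rightarrow> 'a"
  Scale :: "'k \<Rightarrow> 'a \<Rightarrow> 'a"
  Mult :: "'a \<Rightarrow> 'a \<Rightarrow> 'a"

locale k_algebra =
  fixes A :: "('k::field, 'a) algebra"
  assumes zero_closed: "Zero A \<in> Carrier A"
    and add_closed: "\<lbrakk>x \<in> Carrier A; y \<in> Carrier A\<rbrakk> \<Longrightarrow> Add A x y \<in> Carrier A"
    and scale_closed: "x \<in> Carrier A \<Longrightarrow> Scale A c x \<in> Carrier A"
    and mult_closed: "\<lbrakk>x \<in> Carrier A; y \<in> Carrier A\<rbrakk> \<Longrightarrow> Mult A x y \<in> Carrier A"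
    and add_assoc: "\<lbrakk>x \<in> Carrier A; y \<in> Carrier A; z \<in> Carrier A\<rbrakk> \<Longrightarrow>
          Add A (Add A x y) z = Add A x (Add A y z)"
    and add_commute: "\<lbrakk>x \<in> Carrier A; y \<in> Carrier A\<rbrakk> \<Longrightarrow> Add A x y = Add A y x"
    and zero_add: "x \<in> Carrier A \<Longrightarrow> Add A (Zero A) x = x"
    and add_neg: "x \<in> Carrier A \<Longrightarrow> Add A x (Scale A (- 1) x) = Zero A"
    and scale_one: "x \<in> Carrier A \<Longrightarrow> Scale A 1 x = x"
    and scale_scale: "x \<in> Carrier A \<Longrightarrow> Scale A c (Scale A d x) = Scale A (c * d) x"
    and scale_add: "\<lbrakk>x \<in> Carrier A; y \<in> Carrier A\<rbrakk> \<Longrightarrow>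
          Scale A c (Add A x y) = Add A (Scale A c x) (Scale A c y)"
    and add_scale: "x \<in> Carrier A \<Longrightarrow> Scale A (c + d) x = Add A (Scale A c x) (Scale A d x)"
    and mult_assoc: "\<lbrakk>x \<in> Carrier A; y \<in> Carrier A; z \<in> Carrier A\<rbrakk> \<Longrightarrow>
          Mult A (Mult A x y) z = Mult A x (Mult A y z)"
    and mult_add: "\<lbrakk>x \<in> Carrier A; y \<in> Carrier A; z \<in> Carrier A\<rbrakk> \<Longrightarrow>
          Mult A x (Add A y z) = Add A (Mult A x y) (Mult A x z)"
    and add_mult: "\<lbrakk>x \<in> Carrier A; y \<in> Carrier A; z \<in> Carrier A\<rbrakk> \<Longrightarrow>
          Mult A (Add A x y) z = Add A (Mult A x z) (Mult A y z)"
    and scale_mult: "\<lbrakk>x \<in> Carrier A; y \<in> Carrier A\<rbrakk> \<Longrightarrow>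
          Mult A (Scale A c x) y = Scale A c (Mult A x y)"
    and mult_scale: "\<lbrakk>x \<in> Carrier A; y \<in> Carrier A\<rbrakk> \<Longrightarrow>
          Mult A x (Scale A c y) = Scale A c (Mult A x y)"

definition algebra_ideal :: "('k::field, 'a) algebra \<Rightarrow> 'a set \<Rightarrow> bool" where
  "algebra_ideal A I \<longleftrightarrow>
     I \<subseteq> Carrier A \<and> Zero A \<in> I \<and>
     (\<forall>x \<in> I. \<forall>y \<in> I. Add A x y \<in> I) \<and>
     (\<forall>c. \<forall>x \<in> I. Scale A c x \<in> I) \<and>
     (\<forall>a \<in> Carrier A. \<forall>x \<in> I. Mult A a x \<in> I \<and> Mult A x a \<in> I)"

text \<open>The zero algebra counts as simple.\<close>

definition simple_algebra :: "('k::field, 'a) algebra \<Rightarrow> bool" where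
  "simple_algebra A \<longleftrightarrow> (\<forall>I. algebra_ideal A I \<longrightarrow> I = {Zero A} \<or> I = Carrier A)"

definition ideal_generated :: "('k::field, 'a) algebra \<Rightarrow> 'a set \<Rightarrow> 'a set" where
  "ideal_generated A R = \<Inter> {I. algebra_ideal A I \<and> R \<subseteq> I}"

definition algebra_coset :: "('k::field, 'a) algebra \<Rightarrow> 'a set \<Rightarrow> 'a \<Rightarrow> 'a set" where
  "algebra_coset A I x = Add A x ` I"

text \<open>
  For an ideal \<open>I\<close> all the cosets in each of the unions below coincide.
\<close>

definition quotient_algebra ::
    "('k::field, 'a) algebra \<Rightarrow> 'a set \<Rightarrow> ('k, 'a set) algebra" where
  "quotient_algebra A I =
     \<lparr>Carrier = algebra_coset A I ` Carrier A,
      Zero = algebra_coset A I (Zero A),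
      Add = (\<lambda>X Y. \<Union>x\<in>X. \<Union>y\<in>Y. algebra_coset A I (Add A x y)),
      Scale = (\<lambda>c X. \<Union>x\<in>X. algebra_coset A I (Scale A c x)),
      Mult = (\<lambda>X Y. \<Union>x\<in>X. \<Union>y\<in>Y. algebra_coset A I (Mult A x y))\<rparr>"


section \<open>Free algebras\<close>

text \<open>
  The unital free algebra on \<open>'x\<close> is the monoid algebra of the monoid of words, i.e.\ the
  finitely supported functions on words with the convolution product of
  \<^theory>\<open>HOL-Library.Poly_Mapping\<close>, which is stated for additively written monoids.
\<close>

datatype 'x free_word = Word (letters: "'x list")

instantiation free_word :: (type) monoid_add
begin

definition zero_free_word :: "'x free_word" where
  "zero_free_word = Word []"

definition plus_free_word :: "'x free_word \<Rightarrow> 'x free_word \<Rightarrow> 'x free_word" where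
  "plus_free_word u v = Word (letters u @ letters v)"

instance
  by standard (simp_all add: zero_free_word_def plus_free_word_def)

end

text \<open>The free algebra on \<open>X\<close> without unit: only nonempty words occur.\<close>

definition free_algebra :: "'x set \<Rightarrow> ('k::field, 'x free_word \<Rightarrow>\<^sub>0 'k) algebra" where
  "free_algebra X =
     \<lparr>Carrier = {p. \<forall>w \<in> Poly_Mapping.keys p. letters w \<noteq> [] \<and> set (letters w) \<subseteq> X},
      Zero = 0,
      Add = (+),
      Scale = (\<lambda>c p. Poly_Mapping.single 0 c * p),
      Mult = (*)\<rparr>"

definition generator :: "'x \<Rightarrow> 'x free_word \<Rightarrow>\<^sub>0 'k::field" where
  "generator x = Poly_Mapping.single (Word [x]) 1"


section \<open>Leavitt path algebras\<close>

datatype ('v, 'e) lpa_gen = Vertex 'v | Edge 'e | Ghost 'e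

definition lpa_gens :: "('v, 'e) pre_digraph \<Rightarrow> ('v, 'e) lpa_gen set" where
  "lpa_gens E = Vertex ` verts E \<union> Edge ` arcs E \<union> Ghost ` arcs E"

text \<open>Each relation $a = b$ is recorded as the element $a - b$ of the free algebra.\<close>

inductive_set lpa_relations ::
    "('v, 'e) pre_digraph \<Rightarrow> (('v, 'e) lpa_gen free_word \<Rightarrow>\<^sub>0 'k::field) set"
  for E :: "('v, 'e) pre_digraph" where
  vertex_idem: "v \<in> verts E \<Longrightarrow>
    generator (Vertex v) * generator (Vertex v) - generator (Vertex v) \<in> lpa_relations E"
| vertex_orth: "\<lbrakk>v \<in> verts E; w \<in> verts E; v \<noteq> w\<rbrakk> \<Longrightarrow>
    generator (Vertex v) * generator (Vertex w) \<in> lpa_relations E"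
| source_edge: "e \<in> arcs E \<Longrightarrow>
    generator (Vertex (tail E e)) * generator (Edge e) - generator (Edge e) \<in> lpa_relations E"
| edge_range: "e \<in> arcs E \<Longrightarrow>
    generator (Edge e) * generator (Vertex (head E e)) - generator (Edge e) \<in> lpa_relations E"
| range_ghost: "e \<in> arcs E \<Longrightarrow>
    generator (Vertex (head E e)) * generator (Ghost e) - generator (Ghost e) \<in> lpa_relations E"
| ghost_source: "e \<in> arcs E \<Longrightarrow>
    generator (Ghost e) * generator (Vertex (tail E e)) - generator (Ghost e) \<in> lpa_relations E"
| CK1_eq: "e \<in> arcs E \<Longrightarrow>
    generator (Ghost e) * generator (Edge e) - generator (Vertex (head E e)) \<in> lpa_relations E"
| CK1_neq: "\<lbrakk>e \<in> arcs E; f \<in> arcs E; e \<noteq> f\<rbrakk> \<Longrightarrow>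
    generator (Ghost e) * generator (Edge f) \<in> lpa_relations E"
| CK2: "regular_vertex E v \<Longrightarrow>
    generator (Vertex v) - (\<Sum>e\<in>out_arcs E v. generator (Edge e) * generator (Ghost e))
      \<in> lpa_relations E"

type_synonym ('k, 'v, 'e) lpa =
  "('k, (('v, 'e) lpa_gen free_word \<Rightarrow>\<^sub>0 'k) set) algebra"

definition leavitt_path_algebra ::
    "'k::field itself \<Rightarrow> ('v, 'e) pre_digraph \<Rightarrow> ('k, 'v, 'e) lpa" where
  "leavitt_path_algebra K E =
     quotient_algebra (free_algebra (lpa_gens E))
       (ideal_generated (free_algebra (lpa_gens E)) (lpa_relations E))"


section \<open>The construction yields an algebra\<close>

lemma single0_mult: "Poly_Mapping.single 0 (c::'k::field) * p = Poly_Mapping.map ((*) c) p"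
  by (simp add: mult_map_scale_conv_mult)

lemma lookup_single0_mult [simp]:
  "Poly_Mapping.lookup (Poly_Mapping.single 0 (c::'k::field) * p) w = c * Poly_Mapping.lookup p w"
  unfolding single0_mult by (simp add: Poly_Mapping.map.rep_eq when_def)

lemma in_mult_keys: "w \<in> Poly_Mapping.keys (p * q :: 'x free_word \<Rightarrow>\<^sub>0 'k::field) \<Longrightarrow>
  \<exists>u\<in>Poly_Mapping.keys p. \<exists>v\<in>Poly_Mapping.keys q. w = u + v"
  using keys_mult[of p q] by blast

lemma poly_mapping_expand: "p = (\<Sum>w\<in>Poly_Mapping.keys p. Poly_Mapping.single w (Poly_Mapping.lookup p w))"
  by (rule poly_mapping_eqI) (simp add: lookup_sum lookup_single when_def in_keys_iff)

lemma single0_comm: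
  "p * Poly_Mapping.single 0 (c::'k::field) = Poly_Mapping.single 0 c * (p :: 'x free_word \<Rightarrow>\<^sub>0 'k)"
  by (subst (1 2) poly_mapping_expand[of p]) (simp add: sum_distrib_left sum_distrib_right mult_single mult.commute)

lemma k_algebra_free: "k_algebra (free_algebra X :: ('k::field, _) algebra)"
proof
  fix x y :: "'a free_word \<Rightarrow>\<^sub>0 'k" and c d :: 'k
  let ?A = "free_algebra X :: ('k::field, _) algebra"
  show "Zero ?A \<in> Carrier ?A" by (simp add: free_algebra_def)
  show "x \<in> Carrier ?A \<Longrightarrow> y \<in> Carrier ?A \<Longrightarrow> Add ?A x y \<in> Carrier ?A"
    using Poly_Mapping.keys_add[of x y] by (auto simp: free_algebra_def)
  show "x \<in> Carrier ?A \<Longrightarrow> Scale ?A c x \<in> Carrier ?A"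
    by (auto simp: free_algebra_def in_keys_iff)
  show "x \<in> Carrier ?A \<Longrightarrow> y \<in> Carrier ?A \<Longrightarrow> Mult ?A x y \<in> Carrier ?A"
    by (fastforce simp: free_algebra_def plus_free_word_def dest!: in_mult_keys)
  show "Add ?A x (Scale ?A (- 1) x) = Zero ?A"
    by (auto simp: free_algebra_def intro!: poly_mapping_eqI simp: lookup_add)
  show "Scale ?A 1 x = x"
    by (auto simp: free_algebra_def intro!: poly_mapping_eqI simp: lookup_add)
  show "Scale ?A c (Scale ?A d x) = Scale ?A (c * d) x"
    by (simp add: free_algebra_def mult.assoc[symmetric] mult_single)
  show "Scale ?A (c + d) x = Add ?A (Scale ?A c x) (Scale ?A d x)"
    by (simp add: free_algebra_def single_add distrib_right)
  show "Mult ?A x (Scale ?A c y) = Scale ?A c (Mult ?A x y)"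
    by (simp add: free_algebra_def mult.assoc[symmetric] single0_comm)
qed (simp_all add: free_algebra_def algebra_simps)

lemma algebra_ideal_generated:
  assumes "k_algebra A" "R \<subseteq> Carrier A"
  shows "algebra_ideal A (ideal_generated A R)"
proof -
  interpret k_algebra A by fact
  have "algebra_ideal A (Carrier A)"
    by (simp add: algebra_ideal_def zero_closed add_closed scale_closed mult_closed)
  then have "ideal_generated A R \<subseteq> Carrier A"
    unfolding ideal_generated_def using assms(2) by (intro Inter_lower) simp
  then show ?thesis
    unfolding algebra_ideal_def[of A "ideal_generated A R"]
    by (simp add: ideal_generated_def) (simp add: algebra_ideal_def)
qed

context
  fixes A :: "('k::field, 'a) algebra" and I
  assumes A: "k_algebra A" and I: "algebra_ideal A I"
begin

interpretation k_algebra A by (rule A)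

lemma ideal_subD: "x \<in> I \<Longrightarrow> x \<in> Carrier A"
  and ideal_zero: "Zero A \<in> I" 
  and ideal_add: "x \<in> I \<Longrightarrow> y \<in> I \<Longrightarrow> Add A x y \<in> I" 
  and ideal_scale: "x \<in> I \<Longrightarrow> Scale A c x \<in> I"
  and ideal_mult_left: "x \<in> I \<Longrightarrow> a \<in> Carrier A \<Longrightarrow> Mult A a x \<in> I"
  and ideal_mult_right: "x \<in> I \<Longrightarrow> a \<in> Carrier A \<Longrightarrow> Mult A x a \<in> I"
  using I unfolding algebra_ideal_def by blast+

lemma add_zero: "x \<in> Carrier A \<Longrightarrow> Add A x (Zero A) = x"
  by (metis add_commute zero_add zero_closed)

lemma add_left_commute: "\<lbrakk>x \<in> Carrier A; y \<in> Carrier A; z \<in> Carrier A\<rbrakk> \<Longrightarrow>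
   Add A x (Add A y z) = Add A y (Add A x z)"
  by (metis add_assoc add_commute)

lemma coset_absorb:
  assumes "x \<in> Carrier A" "i \<in> I"
  shows "algebra_coset A I (Add A x i) = algebra_coset A I x"
proof -
  have "Add A (Add A x i) j \<in> algebra_coset A I x" if "j \<in> I" for j
    using assms that by (simp add: algebra_coset_def add_assoc ideal_subD ideal_add)
  moreover have "Add A x j \<in> algebra_coset A I (Add A x i)" if "j \<in> I" for j
  proof -
    have "Add A i (Add A (Scale A (- 1) i) j) = j"
      using assms that by (metis ideal_subD add_assoc add_neg scale_closed zero_add)
    then have "Add A x j = Add A (Add A x i) (Add A (Scale A (- 1) i) j)"
      using assms that by (simp add: add_assoc ideal_subD scale_closed add_closed)
    moreover have "Add A (Scale A (- 1) i) j \<in> I"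
      using assms that by (simp add: ideal_add ideal_scale)
    ultimately show ?thesis unfolding algebra_coset_def by (rule image_eqI)
  qed
  ultimately show ?thesis
    unfolding algebra_coset_def by blast
qed

lemma coset_self: "x \<in> Carrier A \<Longrightarrow> x \<in> algebra_coset A I x"
  unfolding algebra_coset_def using ideal_zero by (metis add_zero image_eqI)

lemma in_coset: "x' \<in> algebra_coset A I x \<longleftrightarrow> (\<exists>i\<in>I. x' = Add A x i)"
  unfolding algebra_coset_def by blast

lemma quotient_add:
  assumes "x \<in> Carrier A" "y \<in> Carrier A"
  shows "Add (quotient_algebra A I) (algebra_coset A I x) (algebra_coset A I y) =
    algebra_coset A I (Add A x y)"
proof -
  have *: "algebra_coset A I (Add A x' y') = algebra_coset A I (Add A x y)"
    if x': "x' \<in> algebra_coset A I x" and y': "y' \<in> algebra_coset A I y" for x' y'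
  proof -
    obtain i where i: "i \<in> I" "x' = Add A x i" using x' unfolding in_coset by blast
    obtain j where j: "j \<in> I" "y' = Add A y j" using y' unfolding in_coset by blast
    have "Add A x' y' = Add A (Add A x y) (Add A i j)"
      using assms i j by (simp add: ideal_subD add_closed add_assoc add_left_commute)
    then show ?thesis using assms i j by (simp add: coset_absorb ideal_add add_closed)
  qed
  have "(\<Union>y'\<in>algebra_coset A I y. algebra_coset A I (Add A x' y')) = algebra_coset A I (Add A x y)"
    if "x' \<in> algebra_coset A I x" for x'
    by (rule UN_constant_eq[OF coset_self[OF assms(2)]]) (use *[OF that] in blast)
  then have "(\<Union>x'\<in>algebra_coset A I x. \<Union>y'\<in>algebra_coset A I y. algebra_coset A I (Add A x' y')) =
      algebra_coset A I (Add A x y)"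
    by (intro UN_constant_eq[OF coset_self[OF assms(1)]] ballI)
  then show ?thesis by (simp add: quotient_algebra_def)
qed

lemma quotient_mult:
  assumes "x \<in> Carrier A" "y \<in> Carrier A"
  shows "Mult (quotient_algebra A I) (algebra_coset A I x) (algebra_coset A I y) =
    algebra_coset A I (Mult A x y)"
proof -
  have *: "algebra_coset A I (Mult A x' y') = algebra_coset A I (Mult A x y)"
    if x': "x' \<in> algebra_coset A I x" and y': "y' \<in> algebra_coset A I y" for x' y'
  proof -
    obtain i where i: "i \<in> I" "x' = Add A x i" using x' unfolding in_coset by blast
    obtain j where j: "j \<in> I" "y' = Add A y j" using y' unfolding in_coset by blast
    have "y' \<in> Carrier A" using assms j by (simp add: add_closed ideal_subD)
    moreover have "Mult A x' y' = Add A (Mult A x y) (Add A (Mult A x j) (Mult A i y'))"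
      using assms i j by (simp add: ideal_subD add_closed add_assoc add_left_commute
          mult_add add_mult mult_closed)
    ultimately show ?thesis
      using assms i j
      by (simp add: coset_absorb ideal_add mult_closed ideal_mult_left ideal_mult_right)
  qed
  have "(\<Union>y'\<in>algebra_coset A I y. algebra_coset A I (Mult A x' y')) = algebra_coset A I (Mult A x y)"
    if "x' \<in> algebra_coset A I x" for x'
    by (rule UN_constant_eq[OF coset_self[OF assms(2)]]) (use *[OF that] in blast)
  then have "(\<Union>x'\<in>algebra_coset A I x. \<Union>y'\<in>algebra_coset A I y. algebra_coset A I (Mult A x' y')) =
      algebra_coset A I (Mult A x y)"
    by (intro UN_constant_eq[OF coset_self[OF assms(1)]] ballI)
  then show ?thesis by (simp add: quotient_algebra_def)
qed

lemma quotient_scale: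
  assumes "x \<in> Carrier A"
  shows "Scale (quotient_algebra A I) c (algebra_coset A I x) = algebra_coset A I (Scale A c x)"
proof -
  have "algebra_coset A I (Scale A c x') = algebra_coset A I (Scale A c x)"
    if "x' \<in> algebra_coset A I x" for x'
    using that assms
    by (auto simp: in_coset scale_add ideal_subD scale_closed coset_absorb ideal_scale)
  then have "(\<Union>x'\<in>algebra_coset A I x. algebra_coset A I (Scale A c x')) = algebra_coset A I (Scale A c x)"
    by (intro UN_constant_eq[OF coset_self[OF assms]] ballI)
  then show ?thesis by (simp add: quotient_algebra_def)
qed

lemma quotient_carrier: "Carrier (quotient_algebra A I) = algebra_coset A I ` Carrier A"
 and quotient_zero: "Zero (quotient_algebra A I) = algebra_coset A I (Zero A)"
  by (simp_all add: quotient_algebra_def)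

lemma k_algebra_quotient: "k_algebra (quotient_algebra A I)"
proof
  fix X Y assume "X \<in> Carrier (quotient_algebra A I)" "Y \<in> Carrier (quotient_algebra A I)"
  then obtain x y where "x \<in> Carrier A" "y \<in> Carrier A"
      "X = algebra_coset A I x" "Y = algebra_coset A I y"
    unfolding quotient_carrier by blast
  then show "Add (quotient_algebra A I) X Y = Add (quotient_algebra A I) Y X"
    by (simp add: quotient_add add_commute[of x y])
qed (auto simp: quotient_carrier quotient_zero quotient_add quotient_mult quotient_scale
       add_closed mult_closed scale_closed zero_closed add_assoc zero_add add_neg scale_one
       scale_scale scale_add add_scale mult_assoc mult_add add_mult scale_mult mult_scale)

lemma coset_eq_zero_iff:
  assumes "x \<in> Carrier A"
  shows "algebra_coset A I x = Zero (quotient_algebra A I) \<longleftrightarrow> x \<in> I"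
proof
  assume "algebra_coset A I x = Zero (quotient_algebra A I)"
  then have "x \<in> algebra_coset A I (Zero A)"
    using coset_self[OF assms] by (simp add: quotient_zero)
  then obtain i where "i \<in> I" "x = Add A (Zero A) i" unfolding in_coset by blast
  then show "x \<in> I" by (simp add: zero_add ideal_subD)
next
  assume "x \<in> I"
  then show "algebra_coset A I x = Zero (quotient_algebra A I)"
    using coset_absorb[OF zero_closed, of x] by (simp add: zero_add ideal_subD quotient_zero)
qed

end

lemma generator_in_free_algebra:
  "x \<in> X \<Longrightarrow> (generator x :: _ \<Rightarrow>\<^sub>0 'k::field) \<in> Carrier (free_algebra X)"
  by (auto simp: generator_def free_algebra_def)

lemma free_algebra_diff:
  fixes p q :: "'x free_word \<Rightarrow>\<^sub>0 'k::field"
  shows "p \<in> Carrier (free_algebra X) \<Longrightarrow> q \<in> Carrier (free_algebra X) \<Longrightarrow>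
    p - q \<in> Carrier (free_algebra X)"
  using keys_diff[of p q] by (auto simp: free_algebra_def)

lemma free_algebra_mult:
  fixes p q :: "'x free_word \<Rightarrow>\<^sub>0 'k::field"
  shows "p \<in> Carrier (free_algebra X) \<Longrightarrow> q \<in> Carrier (free_algebra X) \<Longrightarrow>
    p * q \<in> Carrier (free_algebra X)"
  using k_algebra.mult_closed[OF k_algebra_free[of X], of p q] by (simp add: free_algebra_def)

lemma free_algebra_sum:
  fixes f :: "'i \<Rightarrow> 'x free_word \<Rightarrow>\<^sub>0 'k::field"
  shows "(\<And>i. i \<in> S \<Longrightarrow> f i \<in> Carrier (free_algebra X)) \<Longrightarrow> sum f S \<in> Carrier (free_algebra X)"
proof (induction S rule: infinite_finite_induct)
  case (insert x F)
  have "f x \<in> Carrier (free_algebra X)" by (rule insert.prems) simp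
  moreover have "sum f F \<in> Carrier (free_algebra X)" by (rule insert.IH) (rule insert.prems, simp)
  ultimately have "f x + sum f F \<in> Carrier (free_algebra X)"
    using k_algebra.add_closed[OF k_algebra_free[of X], of "f x" "sum f F"]
    by (simp add: free_algebra_def)
  then show ?case using insert.hyps by simp
qed (simp_all add: free_algebra_def)

lemma lpa_relations_subset:
  assumes "wf_digraph E"
  shows "lpa_relations E \<subseteq> Carrier (free_algebra (lpa_gens E) :: ('k::field,_) algebra)"
proof
  interpret wf_digraph E by fact
  fix r :: "_ \<Rightarrow>\<^sub>0 'k" assume "r \<in> lpa_relations E"
  then show "r \<in> Carrier (free_algebra (lpa_gens E) :: ('k::field,_) algebra)"
    by cases (auto intro!: free_algebra_diff free_algebra_mult free_algebra_sum
        generator_in_free_algebra simp: lpa_gens_def regular_vertex_def out_arcs_def)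
qed

theorem k_algebra_leavitt_path_algebra:
  assumes "wf_digraph E" shows "k_algebra (leavitt_path_algebra TYPE('k::field) E)"
  unfolding leavitt_path_algebra_def
  by (intro k_algebra_quotient k_algebra_free algebra_ideal_generated lpa_relations_subset assms)

end

theory Submission
  imports Defs "HOL-Library.Sublist"
begin

text \<open>
  Everything is computed in the unital free algebra. An ideal of the Leavitt path algebra is the
  same as an ideal \<open>J\<close> of the free algebra that contains the ideal \<open>R\<close> generated by the Leavitt
  relations (\<open>simple_quotient_iff\<close>), so simplicity says that only \<open>J = R\<close> and the full carrier occur.

  \<^emph>\<open>The conditions imply simplicity.\<close> Modulo \<open>R\<close> the algebra is spanned by the products
  \<open>\<alpha> w \<beta>\<^sup>*\<close> of a path and a ghost path that end in the same vertex (\<open>word_normal_form\<close>). Let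
  \<open>a\<close> be in \<open>J\<close> but not in \<open>R\<close>. Multiplying on the right by edges shortens the ghost paths
  \<open>\<beta>\<^sup>*\<close>; either some product stays outside \<open>R\<close> and induction applies, or the relations
  \<open>v = \<Sum> e e\<^sup>*\<close> force \<open>a\<close> into \<open>R\<close>, except at sinks and infinite emitters, where a
  combination of paths can be read off directly (\<open>ghost_elimination\<close>). The outcome is a
  combination of paths in \<open>J\<close> that is nonzero as an element of the \<^emph>\<open>free\<close> algebra; from here on
  only its formal coefficients count. Let \<open>\<alpha>\<close> be a shortest path in it, leading from \<open>u\<close> to \<open>v\<close>.
  Multiplying by \<open>\<alpha>\<^sup>* u\<close> on the left and by \<open>v\<close> on the right leaves \<open>k v + \<Sum> k\<^sub>i \<gamma>\<^sub>i\<close> with \<open>k\<close>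
  nonzero and closed paths \<open>\<gamma>\<^sub>i\<close> at \<open>v\<close> of positive length. Condition (L) yields a path \<open>\<tau>\<close> from \<open>v\<close> that is not a prefix of any \<open>\<gamma>\<^sub>i \<tau>\<close> (\<open>walk_escaping_closed_walks\<close>), which means
  \<open>\<tau>\<^sup>* \<gamma>\<^sub>i \<tau> = 0\<close>; so multiplying by \<open>\<tau>\<^sup>*\<close> and \<open>\<tau>\<close> leaves \<open>k\<close> times a vertex (\<open>vertex_in_ideal\<close>). The
  vertices in \<open>J\<close> form a hereditary saturated set, hence are all vertices, and \<open>J\<close> is everything.

  \<^emph>\<open>Simplicity implies the conditions.\<close> Proper ideals are obtained as kernels of
  representations on a space with basis \<open>(E\<^sup>0 - H) \<times> \<int> \<times> \<nat>\<close>, where \<open>H\<close> is hereditary and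
  saturated. An edge with range outside \<open>H\<close> maps the basis vectors over its range injectively to
  basis vectors over its source, and if such edges leave a vertex, then their images partition
  the basis vectors over it; the integer coordinate grows by a constant \<open>\<delta>\<close>. The kernel contains exactly the vertices in
  \<open>H\<close>. If the algebra is simple, then every kernel with \<open>H \<noteq> E\<^sup>0\<close> is \<open>R\<close>, so all these kernels
  agree. Comparing \<open>H\<close> with the empty set gives \<open>H = \<emptyset>\<close>. If a closed path \<open>p\<close> at \<open>v\<close> had no exit,
  then \<open>p - v\<close> would be in the kernel for \<open>\<delta> = 0\<close> but not for \<open>\<delta> = 1\<close>.
\<close>

section \<open>Words and linear extensions in the free algebra\<close>

definition mon :: "'x list \<Rightarrow> 'x free_word \<Rightarrow>\<^sub>0 'k::field" where
  "mon xs = Poly_Mapping.single (Word xs) 1"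

abbreviation scalar :: "'k::field \<Rightarrow> 'x free_word \<Rightarrow>\<^sub>0 'k" where
  "scalar c \<equiv> Poly_Mapping.single 0 c"

text \<open>
  Linear maps out of the free algebra are given by their values on words: \<open>lin_ext\<close> for values in
  the free algebra, \<open>lin_form\<close> for values in the field. Identities between two such maps are
  then checked word by word.
\<close>

definition lin_ext :: "('x list \<Rightarrow> 'x free_word \<Rightarrow>\<^sub>0 'k) \<Rightarrow> ('x free_word \<Rightarrow>\<^sub>0 'k::field) \<Rightarrow> 'x free_word \<Rightarrow>\<^sub>0 'k" where
  "lin_ext f p = (\<Sum>w\<in>Poly_Mapping.keys p. scalar (Poly_Mapping.lookup p w) * f (letters w))"

definition lin_form :: "('x list \<Rightarrow> 'k) \<Rightarrow> ('x free_word \<Rightarrow>\<^sub>0 'k::field) \<Rightarrow> 'k" where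
  "lin_form \<phi> p = (\<Sum>w\<in>Poly_Mapping.keys p. Poly_Mapping.lookup p w * \<phi> (letters w))"

lemma generator_eq_mon: "generator x = mon [x]"
  by (simp add: generator_def mon_def)

lemma mon_append: "mon (xs @ ys) = mon xs * mon ys"
  by (simp add: mon_def mult_single plus_free_word_def)

lemma mon_Nil [simp]: "mon [] = 1"
  by (simp add: mon_def zero_free_word_def[symmetric])

lemma keys_mon [simp]: "Poly_Mapping.keys (mon xs :: _ \<Rightarrow>\<^sub>0 'k::field) = {Word xs}"
  by (simp add: mon_def)

lemma scalar_mon: "scalar c * mon xs = Poly_Mapping.single (Word xs) c"
  by (simp add: mon_def mult_single zero_free_word_def plus_free_word_def)

lemma lin_ext_mon [simp]: "lin_ext mon p = p"
  unfolding lin_ext_def scalar_mon by (simp add: poly_mapping_expand[symmetric])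

lemma lin_ext_add: "lin_ext (\<lambda>w. f w + g w) p = lin_ext f p + lin_ext g p"
  by (simp add: lin_ext_def distrib_left sum.distrib)

lemma lin_ext_sum: "lin_ext (\<lambda>w. \<Sum>i\<in>I. f i w) p = (\<Sum>i\<in>I. lin_ext (f i) p)"
  by (simp add: lin_ext_def sum_distrib_left) (rule sum.swap)

lemma lin_ext_mult_right: "lin_ext (\<lambda>w. f w * q) p = lin_ext f p * q"
  by (simp add: lin_ext_def sum_distrib_right mult.assoc)

lemma lin_ext_mult_left: "lin_ext (\<lambda>w. q * f w) p = q * lin_ext f p"
proof -
  have "scalar c * (q * r) = q * (scalar c * r)" for c and r :: "'a free_word \<Rightarrow>\<^sub>0 'b"
    by (simp add: mult.assoc[symmetric] single0_comm)
  then show ?thesis by (simp add: lin_ext_def sum_distrib_left)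
qed

lemma lin_ext_cong:
  "(\<And>w. w \<in> Poly_Mapping.keys p \<Longrightarrow> f (letters w) = g (letters w)) \<Longrightarrow> lin_ext f p = lin_ext g p"
  by (simp add: lin_ext_def)

definition supported :: "'x list set \<Rightarrow> ('x free_word \<Rightarrow>\<^sub>0 'k::field) \<Rightarrow> bool" where
  "supported S p \<longleftrightarrow> letters ` Poly_Mapping.keys p \<subseteq> S"

lemma supported_zero [simp]: "supported S 0"
  by (simp add: supported_def)

lemma supported_add: "supported S p \<Longrightarrow> supported S q \<Longrightarrow> supported S (p + q)"
  using Poly_Mapping.keys_add[of p q] unfolding supported_def by blast

lemma supported_sum: "(\<And>i. i \<in> I \<Longrightarrow> supported S (f i)) \<Longrightarrow> supported S (sum f I)"
  by (induction I rule: infinite_finite_induct) (auto intro: supported_add)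

lemma supported_scalar: "supported S p \<Longrightarrow> supported S (scalar c * p)"
  by (auto simp: supported_def in_keys_iff)

lemma supported_mon [simp]: "supported S (mon xs) \<longleftrightarrow> xs \<in> S"
  by (simp add: supported_def)

lemma supported_lin_ext:
  "(\<And>w. w \<in> Poly_Mapping.keys p \<Longrightarrow> supported S (f (letters w))) \<Longrightarrow> supported S (lin_ext f p)"
  unfolding lin_ext_def by (intro supported_sum supported_scalar)

lemma supported_mono: "supported S p \<Longrightarrow> S \<subseteq> T \<Longrightarrow> supported T p"
  by (auto simp: supported_def)

lemma supported_keys: "supported S p \<Longrightarrow> w \<in> Poly_Mapping.keys p \<Longrightarrow> letters w \<in> S"
  by (auto simp: supported_def)

lemma lookup_lin_ext:
  "Poly_Mapping.lookup (lin_ext f p) u =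
    (\<Sum>w\<in>Poly_Mapping.keys p. Poly_Mapping.lookup p w * Poly_Mapping.lookup (f (letters w)) u)"
  by (simp add: lin_ext_def lookup_sum)

lemma lin_form_superset:
  assumes "finite S" "Poly_Mapping.keys p \<subseteq> S"
  shows "lin_form \<phi> p = (\<Sum>w\<in>S. Poly_Mapping.lookup p w * \<phi> (letters w))"
  unfolding lin_form_def using assms by (intro sum.mono_neutral_left) (auto simp: in_keys_iff)

lemma lin_form_zero [simp]: "lin_form \<phi> 0 = 0"
  by (simp add: lin_form_def)

lemma lin_form_add: "lin_form \<phi> (p + q) = lin_form \<phi> p + lin_form \<phi> q"
proof -
  let ?S = "Poly_Mapping.keys p \<union> Poly_Mapping.keys q"
  have "lin_form \<phi> (p + q) = (\<Sum>w\<in>?S. Poly_Mapping.lookup (p + q) w * \<phi> (letters w))"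
    by (intro lin_form_superset Poly_Mapping.keys_add) auto
  moreover have "lin_form \<phi> p = (\<Sum>w\<in>?S. Poly_Mapping.lookup p w * \<phi> (letters w))"
    "lin_form \<phi> q = (\<Sum>w\<in>?S. Poly_Mapping.lookup q w * \<phi> (letters w))"
    by (auto intro!: lin_form_superset)
  ultimately show ?thesis
    by (simp add: lookup_add distrib_right sum.distrib)
qed

lemma lin_form_sum: "lin_form \<phi> (sum f I) = (\<Sum>i\<in>I. lin_form \<phi> (f i))"
  by (induction I rule: infinite_finite_induct) (auto simp: lin_form_add)

lemma lin_form_scalar: "lin_form \<phi> (scalar c * p) = c * lin_form \<phi> p"
proof -
  have "lin_form \<phi> (scalar c * p) =
      (\<Sum>w\<in>Poly_Mapping.keys p. Poly_Mapping.lookup (scalar c * p) w * \<phi> (letters w))"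
    by (rule lin_form_superset) (auto simp: in_keys_iff)
  then show ?thesis by (simp add: lin_form_def sum_distrib_left mult.assoc)
qed

lemma lin_form_diff: "lin_form \<phi> (p - q) = lin_form \<phi> p - lin_form \<phi> q"
  using lin_form_add[of \<phi> "p - q" q] by simp

lemma lin_form_mon [simp]: "lin_form \<phi> (mon xs) = \<phi> xs"
  by (simp add: lin_form_def mon_def)

lemma lin_form_lin_ext:
  "lin_form \<phi> (lin_ext f p) = lin_form (\<lambda>xs. lin_form \<phi> (f xs)) p"
  by (simp add: lin_ext_def lin_form_sum lin_form_scalar lin_form_def[of "\<lambda>xs. lin_form \<phi> (f xs)"])

text \<open>
  A product is bilinear in its factors, so a form on products can be evaluated by letting first one
  factor and then the other run through its words.
\<close>

lemma lin_form_mult_left: "lin_form \<phi> (q * p) = lin_form (\<lambda>xs. lin_form (\<lambda>ys. \<phi> (xs @ ys)) p) q"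
proof -
  have *: "lin_form \<phi> (mon xs * p) = lin_form (\<lambda>ys. \<phi> (xs @ ys)) p" for xs
  proof -
    have "mon xs * p = lin_ext (\<lambda>ys. mon (xs @ ys)) p"
      using lin_ext_mult_left[of "mon xs" mon p] by (simp add: mon_append)
    then show ?thesis by (simp add: lin_form_lin_ext)
  qed
  have "q * p = lin_ext (\<lambda>xs. mon xs * p) q"
    by (simp add: lin_ext_mult_right)
  then show ?thesis by (simp add: lin_form_lin_ext *)
qed

lemma lin_form_swap: "lin_form (\<lambda>xs. lin_form (f xs) p) q = lin_form (\<lambda>ys. lin_form (\<lambda>xs. f xs ys) q) p"
  unfolding lin_form_def sum_distrib_left
  by (subst sum.swap) (simp add: mult.left_commute)

lemma lin_form_const_zero [simp]: "lin_form (\<lambda>xs. 0) p = 0"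
  by (simp add: lin_form_def)


section \<open>Ideals of free algebras and of quotients\<close>

lemma free_algebra_simps:
  "Zero (free_algebra X) = 0" "Add (free_algebra X) = (+)" "Mult (free_algebra X) = (*)"
  "Scale (free_algebra X) c p = scalar c * p"
  by (simp_all add: free_algebra_def)

lemma in_free_algebra: "p \<in> Carrier (free_algebra X) \<longleftrightarrow> supported {xs. xs \<noteq> [] \<and> set xs \<subseteq> X} p"
  by (auto simp: free_algebra_def supported_def)

locale free_algebra_ideal =
  fixes X :: "'x set" and R :: "('x free_word \<Rightarrow>\<^sub>0 'k::field) set"
  assumes ideal: "algebra_ideal (free_algebra X) R"
begin

lemma carrier: "p \<in> R \<Longrightarrow> p \<in> Carrier (free_algebra X)"
  and zero [simp]: "0 \<in> R"
  and add: "p \<in> R \<Longrightarrow> q \<in> R \<Longrightarrow> p + q \<in> R"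
  and scale: "p \<in> R \<Longrightarrow> scalar c * p \<in> R"
  using ideal by (auto simp: algebra_ideal_def free_algebra_simps)

lemma uminus: "p \<in> R \<Longrightarrow> - p \<in> R"
  using scale[of p "- 1"] by (metis mult_minus1 single_one single_uminus)

lemma sum: "(\<And>i. i \<in> I \<Longrightarrow> f i \<in> R) \<Longrightarrow> sum f I \<in> R"
  by (induction I rule: infinite_finite_induct) (auto intro: add)

lemma lin_ext_mem:
  "(\<And>w. w \<in> Poly_Mapping.keys p \<Longrightarrow> f (letters w) \<in> R) \<Longrightarrow> lin_ext f p \<in> R"
  unfolding lin_ext_def by (intro sum scale)

lemma mult_mon:
  assumes "p \<in> R" "set xs \<subseteq> X"
  shows "mon xs * p \<in> R" "p * mon xs \<in> R"
proof -
  have *: "mon xs \<in> Carrier (free_algebra X)" if "xs \<noteq> []"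
    using that assms by (simp add: in_free_algebra)
  show "mon xs * p \<in> R" "p * mon xs \<in> R"
    using ideal assms * by (cases "xs = []"; auto simp: algebra_ideal_def free_algebra_simps)+
qed

text \<open>
  An ideal of the non-unital free algebra is even closed under multiplication by elements with a
  constant term, since it is closed under scalars.
\<close>

lemma mult:
  assumes "p \<in> R" "supported {xs. set xs \<subseteq> X} q"
  shows "q * p \<in> R" "p * q \<in> R"
proof -
  have "lin_ext (\<lambda>xs. mon xs * p) q \<in> R"
    using assms by (auto intro!: lin_ext_mem mult_mon dest: supported_keys)
  then show "q * p \<in> R" by (simp add: lin_ext_mult_right)
  have "lin_ext (\<lambda>xs. p * mon xs) q \<in> R"
    using assms by (auto intro!: lin_ext_mem mult_mon dest: supported_keys)
  then show "p * q \<in> R" by (simp add: lin_ext_mult_left)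
qed

definition cong :: "('x free_word \<Rightarrow>\<^sub>0 'k) \<Rightarrow> ('x free_word \<Rightarrow>\<^sub>0 'k) \<Rightarrow> bool" (infix "\<approx>" 50) where
  "p \<approx> q \<longleftrightarrow> p - q \<in> R"

lemma cong_refl [simp]: "p \<approx> p"
  by (simp add: cong_def)

lemma cong_sym: "p \<approx> q \<Longrightarrow> q \<approx> p"
  using uminus[of "p - q"] by (simp add: cong_def)

lemma cong_trans [trans]: "p \<approx> q \<Longrightarrow> q \<approx> r \<Longrightarrow> p \<approx> r"
  using add[of "p - q" "q - r"] by (simp add: cong_def)

lemma cong_zero: "p \<approx> 0 \<longleftrightarrow> p \<in> R"
  by (simp add: cong_def)

lemma cong_mem: "p \<approx> q \<Longrightarrow> p \<in> R \<longleftrightarrow> q \<in> R"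
  using cong_sym cong_trans cong_zero by blast

lemma cong_add: "p \<approx> q \<Longrightarrow> p' \<approx> q' \<Longrightarrow> p + p' \<approx> q + q'"
  using add[of "p - q" "p' - q'"] by (simp add: cong_def algebra_simps)

lemma cong_sum: "(\<And>i. i \<in> I \<Longrightarrow> f i \<approx> g i) \<Longrightarrow> sum f I \<approx> sum g I"
  by (induction I rule: infinite_finite_induct) (auto intro: cong_add)

lemma cong_lin_ext:
  "(\<And>w. w \<in> Poly_Mapping.keys p \<Longrightarrow> f (letters w) \<approx> g (letters w)) \<Longrightarrow> lin_ext f p \<approx> lin_ext g p"
  using lin_ext_mem[of p "\<lambda>w. f w - g w"]
  by (simp add: cong_def lin_ext_def right_diff_distrib sum_subtractf)

lemma cong_mon_mult:
  assumes "p \<approx> q" "set xs \<subseteq> X" "set ys \<subseteq> X"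
  shows "mon xs * p * mon ys \<approx> mon xs * q * mon ys"
  using mult_mon(2)[OF mult_mon(1)[of "p - q" xs] , of ys] assms
  by (simp add: cong_def algebra_simps)

lemma cong_word:
  assumes "mon us \<approx> mon vs" "set xs \<subseteq> X" "set ys \<subseteq> X"
  shows "mon (xs @ us @ ys) \<approx> mon (xs @ vs @ ys)"
  using cong_mon_mult[OF assms] by (simp add: mon_append mult.assoc)

lemma cong_word_zero:
  assumes "mon us \<approx> 0" "set xs \<subseteq> X" "set ys \<subseteq> X"
  shows "mon (xs @ us @ ys) \<approx> 0"
  using cong_mon_mult[OF assms] by (simp add: mon_append mult.assoc)

end


text \<open>
  The correspondence between ideals of a quotient and ideals above the kernel, by taking images and
  preimages under the quotient map.
\<close>

lemma simple_quotient_iff: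
  assumes A: "k_algebra A" and I: "algebra_ideal A I"
  shows "simple_algebra (quotient_algebra A I) \<longleftrightarrow>
    (\<forall>J. algebra_ideal A J \<and> I \<subseteq> J \<longrightarrow> J = I \<or> J = Carrier A)"
proof -
  interpret k_algebra A by fact
  let ?Q = "quotient_algebra A I" and ?q = "algebra_coset A I"
  note q = quotient_add[OF A I] quotient_mult[OF A I] quotient_scale[OF A I]
    quotient_zero[OF A I] quotient_carrier[OF A I]
  show ?thesis
  proof (intro iffI allI impI)
    fix J assume simple: "simple_algebra ?Q" and J: "algebra_ideal A J \<and> I \<subseteq> J"
    have sub: "J \<subseteq> Carrier A" using J by (simp add: algebra_ideal_def)
    have J': "Zero A \<in> J" "\<And>x y. x \<in> J \<Longrightarrow> y \<in> J \<Longrightarrow> Add A x y \<in> J" "\<And>c x. x \<in> J \<Longrightarrow> Scale A c x \<in> J"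
      "\<And>a x. a \<in> Carrier A \<Longrightarrow> x \<in> J \<Longrightarrow> Mult A a x \<in> J"
      "\<And>a x. a \<in> Carrier A \<Longrightarrow> x \<in> J \<Longrightarrow> Mult A x a \<in> J"
      "\<And>x. x \<in> J \<Longrightarrow> x \<in> Carrier A"
      using J by (auto simp: algebra_ideal_def)
    have "algebra_ideal ?Q (?q ` J)"
      unfolding algebra_ideal_def using sub
      by (auto simp: q(4,5) q(1,2)[OF J'(6) J'(6)] q(3)[OF J'(6)] q(2)[OF J'(6)] q(2)[OF _ J'(6)] J'(1-5) intro!: imageI)
    then consider "?q ` J = {Zero ?Q}" | "?q ` J = Carrier ?Q"
      using simple unfolding simple_algebra_def by metis
    then show "J = I \<or> J = Carrier A"
    proof cases
      case 1
      have "J \<subseteq> I"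
      proof
        fix x assume x: "x \<in> J"
        then have "?q x = Zero ?Q" using 1 by (metis imageI singletonD)
        then show "x \<in> I" using coset_eq_zero_iff[OF A I] x J'(6) by blast
      qed
      then show ?thesis using J by blast
    next
      case 2
      have "x \<in> J" if x: "x \<in> Carrier A" for x
      proof -
        from x 2 have "?q x \<in> ?q ` J" by (simp add: q)
        then obtain y where y: "y \<in> J" "?q x = ?q y" by (metis imageE)
        then have "x \<in> ?q y" using coset_self[OF A I x] by simp
        then obtain i where "i \<in> I" "x = Add A y i" using in_coset[OF A I] by blast
        then show "x \<in> J" using y J by (auto simp: algebra_ideal_def)
      qed
      then show ?thesis using sub by blast
    qed
  next
    assume all: "\<forall>J. algebra_ideal A J \<and> I \<subseteq> J \<longrightarrow> J = I \<or> J = Carrier A"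
    show "simple_algebra ?Q"
      unfolding simple_algebra_def
    proof (intro allI impI)
      fix M assume M: "algebra_ideal ?Q M"
      define J where "J = {x \<in> Carrier A. ?q x \<in> M}"
      have "algebra_ideal A J"
        unfolding algebra_ideal_def
      proof (intro conjI ballI allI)
        show "J \<subseteq> Carrier A" by (auto simp: J_def)
        show "Zero A \<in> J" using M by (simp add: J_def algebra_ideal_def q(4) zero_closed)
      next
        fix x y assume "x \<in> J" "y \<in> J"
        then show "Add A x y \<in> J"
          using M by (simp add: J_def algebra_ideal_def q(1)[symmetric] add_closed)
      next
        fix c x assume "x \<in> J"
        then show "Scale A c x \<in> J"
          using M by (simp add: J_def algebra_ideal_def q(3)[symmetric] scale_closed)
      next
        fix a x assume "a \<in> Carrier A" "x \<in> J"
        moreover then have "?q a \<in> Carrier ?Q" by (simp add: q(5))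
        ultimately show "Mult A a x \<in> J" "Mult A x a \<in> J"
          using M by (simp_all add: J_def algebra_ideal_def q(2)[symmetric] mult_closed)
      qed
      moreover have "I \<subseteq> J"
      proof
        fix x assume x: "x \<in> I"
        then have "x \<in> Carrier A" using I by (auto simp: algebra_ideal_def)
        moreover then have "?q x = Zero ?Q" using x coset_eq_zero_iff[OF A I] by blast
        ultimately show "x \<in> J" using M by (simp add: J_def algebra_ideal_def)
      qed
      ultimately consider "J = I" | "J = Carrier A" using all by blast
      moreover have M_eq: "M = ?q ` J"
        using M by (auto simp: J_def algebra_ideal_def q)
      moreover have "?q ` I = {Zero ?Q}"
        using coset_eq_zero_iff[OF A I] ideal_subD[OF A I] ideal_zero[OF A I] by force
      ultimately show "M = {Zero ?Q} \<or> M = Carrier ?Q"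
        unfolding q(5) by cases simp_all
    qed
  qed
qed


section \<open>Walks that escape finitely many closed walks\<close>

text \<open>
  If \<open>\<tau>\<close> is a prefix of \<open>\<gamma> @ \<tau>\<close>, then it is an initial segment of the periodic word
  \<open>\<gamma>\<gamma>\<gamma>\<dots>\<close>, and initial segments of one word are comparable.
\<close>

lemma periodic_prefixes_comparable:
  assumes "\<gamma> \<noteq> []" "prefix \<tau> (\<gamma> @ \<tau>)" "prefix \<tau>' (\<gamma> @ \<tau>')"
  shows "prefix \<tau> \<tau>' \<or> prefix \<tau>' \<tau>"
  using assms(2,3)
proof (induction "length \<tau>" arbitrary: \<tau> \<tau>' rule: less_induct)
  case less
  consider "prefix \<tau> \<gamma>" | \<tau>1 where "\<tau> = \<gamma> @ \<tau>1"
    using less.prems(1) unfolding prefix_append by blast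
  note c1 = this
  consider "prefix \<tau>' \<gamma>" | \<tau>1' where "\<tau>' = \<gamma> @ \<tau>1'"
    using less.prems(2) unfolding prefix_append by blast
  note c2 = this
  show ?case
  proof (cases rule: c1)
    case 1
    then show ?thesis
      using c2 prefix_same_cases[of \<tau> \<gamma> \<tau>'] by (metis prefix_order.trans prefixI)
  next
    case \<tau>1: (2 \<tau>1)
    show ?thesis
    proof (cases rule: c2)
      case 1
      then show ?thesis using \<tau>1 by (metis prefix_order.trans prefixI)
    next
      case \<tau>1': (2 \<tau>1')
      have "prefix \<tau>1 \<tau>1' \<or> prefix \<tau>1' \<tau>1"
        using less.hyps[of \<tau>1 \<tau>1'] less.prems assms(1) by (simp add: \<tau>1 \<tau>1')
      then show ?thesis by (simp add: \<tau>1 \<tau>1')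
    qed
  qed
qed

context wf_digraph
begin

lemma awalk_arcs: "awalk u p v \<Longrightarrow> e \<in> set p \<Longrightarrow> e \<in> arcs G"
  by (auto simp: awalk_def)

lemma awalk_replicate:
  "awalk v \<gamma> v \<Longrightarrow> awalk v (concat (replicate m \<gamma>)) v"
  by (induction m) (auto simp: awalk_Nil_iff)

text \<open>
  Going \<open>m\<close> times around a closed walk and then leaving it through an exit gives infinitely many
  pairwise incomparable walks \<open>\<tau> m\<close>. By \<open>periodic_prefixes_comparable\<close> each \<open>\<gamma>\<close> in
  \<open>\<Gamma>\<close> excludes at most one of them, so finitely many \<open>\<gamma>\<close> rule out only finitely many \<open>m\<close>.
\<close>

lemma walk_escaping_closed_walks:
  assumes L: "condition_L G" and v: "v \<in> verts G"
    and \<Gamma>: "finite \<Gamma>" "\<And>\<gamma>. \<gamma> \<in> \<Gamma> \<Longrightarrow> \<gamma> \<noteq> [] \<and> awalk v \<gamma> v"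
  shows "\<exists>\<tau> x. awalk v \<tau> x \<and> (\<forall>\<gamma>\<in>\<Gamma>. \<not> prefix \<tau> (\<gamma> @ \<tau>))"
proof (cases "\<Gamma> = {}")
  case True
  then show ?thesis using v by (auto intro!: exI[of _ "[]"] simp: awalk_Nil_iff)
next
  case False
  then obtain \<gamma> where "\<gamma> \<in> \<Gamma>" by blast
  then have \<gamma>: "\<gamma> \<noteq> []" "awalk v \<gamma> v" using \<Gamma> by auto
  then have "closed_w \<gamma>" by (auto simp: closed_w_def)
  then obtain f where "is_exit G \<gamma> f" using L by (auto simp: condition_L_def)
  then obtain i where i: "f \<in> arcs G" "i < length \<gamma>" "tail G f = tail G (\<gamma> ! i)" "f \<noteq> \<gamma> ! i"
    by (auto simp: is_exit_def)
  define \<tau> where "\<tau> m = concat (replicate m \<gamma>) @ take i \<gamma> @ [f]" for m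
  have walk: "awalk v (\<tau> m) (head G f)" for m
  proof -
    have "\<gamma> = take i \<gamma> @ \<gamma> ! i # drop (Suc i) \<gamma>"
      using i(2) by (rule id_take_nth_drop)
    then have "awalk v (take i \<gamma> @ \<gamma> ! i # drop (Suc i) \<gamma>) v" using \<gamma>(2) by simp
    then obtain x where x: "awalk v (take i \<gamma>) x" "awalk x (\<gamma> ! i # drop (Suc i) \<gamma>) v"
      by (auto simp: awalk_Cons_iff)
    then have "x = tail G f" by (simp add: awalk_Cons_iff i(3))
    then have "awalk v (take i \<gamma> @ [f]) (head G f)"
      using x i(1) by (auto simp: awalk_simps intro: head_in_verts)
    then show ?thesis
      using awalk_replicate[OF \<gamma>(2), of m] unfolding \<tau>_def by (metis awalk_appendI)
  qed
  have incomparable: "\<not> prefix (\<tau> m) (\<tau> n)" if "m < n" for m n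
  proof
    assume prefix: "prefix (\<tau> m) (\<tau> n)"
    obtain k where n: "n = m + Suc k" using \<open>m < n\<close> less_imp_Suc_add by auto
    have "concat (replicate n \<gamma>) = concat (replicate m \<gamma>) @ concat (replicate (Suc k) \<gamma>)"
      unfolding n replicate_add by (simp only: concat_append)
    then have "\<tau> n = concat (replicate m \<gamma>) @ \<gamma> @ \<tau> k"
      by (simp add: \<tau>_def)
    then have "prefix (take i \<gamma> @ [f]) (\<gamma> @ \<tau> k)" using prefix by (simp add: \<tau>_def)
    then obtain zs where "\<gamma> @ \<tau> k = take i \<gamma> @ [f] @ zs" by (auto simp: prefix_def)
    then have "(\<gamma> @ \<tau> k) ! i = (take i \<gamma> @ [f] @ zs) ! i" by simp
    then show False using i by (simp add: nth_append)
  qed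
  have "strict_mono (\<lambda>m. length (\<tau> m))"
    using \<gamma>(1) by (auto simp: \<tau>_def strict_mono_Suc_iff)
  have longer: "\<not> prefix (\<tau> n) (\<tau> m)" if "m < n" for m n
    using strict_monoD[OF \<open>strict_mono _\<close> that] prefix_length_le by force
  have "finite {m. prefix (\<tau> m) (\<gamma> @ \<tau> m)}" if "\<gamma> \<in> \<Gamma>" for \<gamma>
  proof -
    have eq: "m = n" if "prefix (\<tau> m) (\<gamma> @ \<tau> m)" "prefix (\<tau> n) (\<gamma> @ \<tau> n)" for m n
      using periodic_prefixes_comparable[OF _ that] \<open>\<gamma> \<in> \<Gamma>\<close> \<Gamma>(2) incomparable longer
      by (metis linorder_neqE_nat)
    show ?thesis
    proof (cases "\<exists>m. prefix (\<tau> m) (\<gamma> @ \<tau> m)")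
      case True
      then obtain m where "prefix (\<tau> m) (\<gamma> @ \<tau> m)" by blast
      then have "{m. prefix (\<tau> m) (\<gamma> @ \<tau> m)} \<subseteq> {m}" using eq by blast
      then show ?thesis by (rule finite_subset) simp
    qed simp
  qed
  then have "finite (\<Union>\<gamma>\<in>\<Gamma>. {m. prefix (\<tau> m) (\<gamma> @ \<tau> m)})"
    using \<Gamma>(1) by blast
  then obtain m where "m \<notin> (\<Union>\<gamma>\<in>\<Gamma>. {m. prefix (\<tau> m) (\<gamma> @ \<tau> m)})"
    using ex_new_if_finite infinite_UNIV_nat by blast
  then show ?thesis using walk by blast
qed

end

section \<open>Normal forms modulo the Leavitt relations\<close>

lemma lpa_gens_iff:
  "Vertex v \<in> lpa_gens G \<longleftrightarrow> v \<in> verts G"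
  "Edge e \<in> lpa_gens G \<longleftrightarrow> e \<in> arcs G"
  "Ghost e \<in> lpa_gens G \<longleftrightarrow> e \<in> arcs G"
  "Vertex ` V \<subseteq> lpa_gens G \<longleftrightarrow> V \<subseteq> verts G"
  "Edge ` F \<subseteq> lpa_gens G \<longleftrightarrow> F \<subseteq> arcs G"
  "Ghost ` F \<subseteq> lpa_gens G \<longleftrightarrow> F \<subseteq> arcs G"
  by (auto simp: lpa_gens_def)

text \<open>
  The results below apply both to the ideal generated by the relations and to the ideals above it.
\<close>

locale lpa_ideal = wf_digraph G + free_algebra_ideal "lpa_gens G" R
  for G :: "('v, 'e) pre_digraph"
    and R :: "(('v, 'e) lpa_gen free_word \<Rightarrow>\<^sub>0 'k::field) set" +
  assumes relations: "lpa_relations G \<subseteq> R"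
begin

declare lpa_gens_iff [simp]

lemma relation_mon:
  shows "v \<in> verts G \<Longrightarrow> mon [Vertex v, Vertex v] \<approx> mon [Vertex v]"
    and "v \<in> verts G \<Longrightarrow> w \<in> verts G \<Longrightarrow> v \<noteq> w \<Longrightarrow> mon [Vertex v, Vertex w] \<approx> 0"
    and "e \<in> arcs G \<Longrightarrow> mon [Vertex (tail G e), Edge e] \<approx> mon [Edge e]"
    and "e \<in> arcs G \<Longrightarrow> mon [Edge e, Vertex (head G e)] \<approx> mon [Edge e]"
    and "e \<in> arcs G \<Longrightarrow> mon [Vertex (head G e), Ghost e] \<approx> mon [Ghost e]"
    and "e \<in> arcs G \<Longrightarrow> mon [Ghost e, Vertex (tail G e)] \<approx> mon [Ghost e]"
    and "e \<in> arcs G \<Longrightarrow> mon [Ghost e, Edge e] \<approx> mon [Vertex (head G e)]"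
    and "e \<in> arcs G \<Longrightarrow> f \<in> arcs G \<Longrightarrow> e \<noteq> f \<Longrightarrow> mon [Ghost e, Edge f] \<approx> 0"
    and "regular_vertex G v \<Longrightarrow> mon [Vertex v] \<approx> (\<Sum>e\<in>out_arcs G v. mon [Edge e, Ghost e])"
proof -
  have "mon [x, y] = generator x * generator y" for x y :: "('v, 'e) lpa_gen"
    by (simp add: generator_eq_mon mon_append[symmetric])
  note eqs = this generator_eq_mon[symmetric] cong_def
  show "v \<in> verts G \<Longrightarrow> mon [Vertex v, Vertex v] \<approx> mon [Vertex v]"
    "v \<in> verts G \<Longrightarrow> w \<in> verts G \<Longrightarrow> v \<noteq> w \<Longrightarrow> mon [Vertex v, Vertex w] \<approx> 0"
    "e \<in> arcs G \<Longrightarrow> mon [Vertex (tail G e), Edge e] \<approx> mon [Edge e]"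
    "e \<in> arcs G \<Longrightarrow> mon [Edge e, Vertex (head G e)] \<approx> mon [Edge e]"
    "e \<in> arcs G \<Longrightarrow> mon [Vertex (head G e), Ghost e] \<approx> mon [Ghost e]"
    "e \<in> arcs G \<Longrightarrow> mon [Ghost e, Vertex (tail G e)] \<approx> mon [Ghost e]"
    "e \<in> arcs G \<Longrightarrow> mon [Ghost e, Edge e] \<approx> mon [Vertex (head G e)]"
    "e \<in> arcs G \<Longrightarrow> f \<in> arcs G \<Longrightarrow> e \<noteq> f \<Longrightarrow> mon [Ghost e, Edge f] \<approx> 0"
    "regular_vertex G v \<Longrightarrow> mon [Vertex v] \<approx> (\<Sum>e\<in>out_arcs G v. mon [Edge e, Ghost e])"
    using relations
    by (simp_all add: eqs subset_iff lpa_relations.intros)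
qed

lemmas word_rules = relation_mon(1,3-7)[THEN cong_word, simplified]
lemmas word_zero_rules = relation_mon(2,8)[THEN cong_word_zero, simplified]

lemma edge_target:
  assumes "awalk u \<alpha> w" "set xs \<subseteq> lpa_gens G" "set ys \<subseteq> lpa_gens G"
  shows "mon (xs @ Vertex u # map Edge \<alpha> @ Vertex w # ys) \<approx> mon (xs @ map Edge \<alpha> @ Vertex w # ys)"
proof (cases \<alpha>)
  case Nil
  then show ?thesis using word_rules(1)[of u xs ys] assms by (auto simp: awalk_simps)
next
  case (Cons e \<alpha>')
  then have "set \<alpha>' \<subseteq> arcs G" "w \<in> verts G" using assms by (auto dest: awalk_last_in_verts awalk_arcs)
  then show ?thesis using word_rules(2)[of e xs "map Edge \<alpha>' @ Vertex w # ys"] assms Cons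
    by (auto simp: awalk_simps)
qed

text \<open>
  The vertex in the middle makes the empty paths visible, so that every normal form is a nonempty
  word.
\<close>

definition normal_word :: "'e list \<Rightarrow> 'v \<Rightarrow> 'e list \<Rightarrow> ('v, 'e) lpa_gen list" where
  "normal_word \<alpha> w \<beta> = map Edge \<alpha> @ Vertex w # map Ghost (rev \<beta>)"

lemma set_normal_word:
  "awalk u \<alpha> w \<Longrightarrow> awalk v \<beta> w \<Longrightarrow> set (normal_word \<alpha> w \<beta>) \<subseteq> lpa_gens G"
  by (auto simp: normal_word_def dest: awalk_last_in_verts awalk_arcs)

lemma normal_word_vertex:
  assumes "awalk u \<alpha> w" "awalk v \<beta> w" "set ys \<subseteq> lpa_gens G"
  shows "mon (normal_word \<alpha> w \<beta> @ Vertex v # ys) \<approx> mon (normal_word \<alpha> w \<beta> @ ys)"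
proof (cases \<beta>)
  case Nil
  moreover have "set \<alpha> \<subseteq> arcs G" using assms(1) by (auto dest: awalk_arcs)
  ultimately show ?thesis using word_rules(1)[of w "map Edge \<alpha>" ys] assms
    by (auto simp: awalk_simps normal_word_def)
next
  case (Cons e \<beta>')
  then have "set \<alpha> \<subseteq> arcs G" "set \<beta>' \<subseteq> arcs G" "w \<in> verts G" "e \<in> arcs G" "v = tail G e"
    using assms by (auto dest: awalk_last_in_verts awalk_arcs simp: awalk_simps)
  then show ?thesis using word_rules(5)[of e "map Edge \<alpha> @ Vertex w # map Ghost (rev \<beta>')" ys] assms Cons
    by (auto simp: normal_word_def)
qed

lemma normal_word_vertex_zero:
  assumes "awalk u \<alpha> w" "awalk v \<beta> w" "v' \<in> verts G" "v' \<noteq> v" "set ys \<subseteq> lpa_gens G"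
  shows "mon (normal_word \<alpha> w \<beta> @ Vertex v' # ys) \<approx> 0"
proof -
  have "mon (normal_word \<alpha> w \<beta> @ Vertex v' # ys) \<approx> mon (normal_word \<alpha> w \<beta> @ Vertex v # Vertex v' # ys)"
    using normal_word_vertex[OF assms(1,2), of "Vertex v' # ys"] assms(3,5)
    by (auto intro: cong_sym)
  also have "\<dots> \<approx> 0"
    using word_zero_rules(1)[of v v' "normal_word \<alpha> w \<beta>" ys] assms set_normal_word[OF assms(1,2)]
    by (auto dest: awalk_hd_in_verts)
  finally show ?thesis .
qed

text \<open>
  Appending a letter to \<open>\<alpha> w \<beta>\<^sup>*\<close> either gives zero or another such product: a ghost edge
  lengthens \<open>\<beta>\<close>, an edge cancels against the first edge of \<open>\<beta>\<close> or, if \<open>\<beta>\<close> is empty,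
  lengthens \<open>\<alpha>\<close>.
\<close>

lemma word_normal_form:
  assumes "xs \<noteq> []" "set xs \<subseteq> lpa_gens G"
  shows "mon xs \<approx> 0 \<or>
    (\<exists>u v \<alpha> w \<beta>. awalk u \<alpha> w \<and> awalk v \<beta> w \<and> mon xs \<approx> mon (normal_word \<alpha> w \<beta>))"
  using assms
proof (induction xs rule: rev_nonempty_induct)
  case (single x)
  show ?case
  proof (cases x)
    case (Vertex v)
    then show ?thesis using single
      by (intro disjI2 exI[of _ v] exI[of _ "[]"]) (auto simp: awalk_simps normal_word_def)
  next
    case (Edge e)
    then have "mon [x] \<approx> mon (normal_word [e] (head G e) [])"
      using single word_rules(3)[of e "[]" "[]"] by (auto simp: normal_word_def intro: cong_sym)
    moreover have "awalk (tail G e) [e] (head G e)" "awalk (head G e) [] (head G e)"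
      using single Edge by (auto simp: awalk_simps)
    ultimately show ?thesis by blast
  next
    case (Ghost e)
    then have "mon [x] \<approx> mon (normal_word [] (head G e) [e])"
      using single word_rules(4)[of e "[]" "[]"] by (auto simp: normal_word_def intro: cong_sym)
    moreover have "awalk (tail G e) [e] (head G e)" "awalk (head G e) [] (head G e)"
      using single Ghost by (auto simp: awalk_simps)
    ultimately show ?thesis by blast
  qed
next
  case (snoc x xs)
  then consider "mon xs \<approx> 0"
    | u v \<alpha> w \<beta> where "awalk u \<alpha> w" "awalk v \<beta> w" "mon xs \<approx> mon (normal_word \<alpha> w \<beta>)"
    by auto
  then show ?case
  proof cases
    case 1
    then show ?thesis using cong_word_zero[of xs "[]" "[x]"] snoc.prems by auto
  next
    case 2
    note walks = 2(1,2)
    note set = set_normal_word[OF walks]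
    have \<alpha>: "set \<alpha> \<subseteq> arcs G" and \<beta>: "set \<beta> \<subseteq> arcs G" and w: "w \<in> verts G"
      using walks by (auto dest: awalk_last_in_verts awalk_arcs)
    have step: "mon (xs @ [x]) \<approx> mon (normal_word \<alpha> w \<beta> @ [x])"
      using cong_word[OF 2(3), of "[]" "[x]"] snoc.prems by auto
    show ?thesis
    proof (cases x)
      case (Vertex v')
      then have v': "v' \<in> verts G" using snoc.prems by simp
      show ?thesis
      proof (cases "v' = v")
        case True
        then have "mon (xs @ [x]) \<approx> mon (normal_word \<alpha> w \<beta>)"
          using cong_trans[OF step] normal_word_vertex[OF walks, of "[]"] Vertex by simp
        then show ?thesis using walks by blast
      next
        case False
        then show ?thesis
          using cong_trans[OF step] normal_word_vertex_zero[OF walks v' False, of "[]"] Vertex by auto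
      qed
    next
      case (Edge f)
      then have f: "f \<in> arcs G" using snoc.prems by simp
      show ?thesis
      proof (cases \<beta>)
        case Nil
        then have v: "v = w" using walks by (simp add: awalk_simps)
        have "mon (normal_word \<alpha> w \<beta> @ [x]) \<approx> mon (normal_word \<alpha> w \<beta> @ [Vertex (tail G f), x])"
          using word_rules(2)[of f "normal_word \<alpha> w \<beta>" "[]"] set f Edge by (auto intro: cong_sym)
        note step = cong_trans[OF step this]
        show ?thesis
        proof (cases "tail G f = w")
          case True
          have "mon (normal_word \<alpha> w \<beta> @ [x]) \<approx> mon (map Edge (\<alpha> @ [f]))"
            using word_rules(2)[of f "map Edge \<alpha>" "[]"] \<alpha> f Edge Nil True
            by (auto simp: normal_word_def)
          also have "\<dots> \<approx> mon (normal_word (\<alpha> @ [f]) (head G f) [])"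
            using word_rules(3)[of f "map Edge \<alpha>" "[]"] \<alpha> f
            by (auto simp: normal_word_def intro: cong_sym)
          finally have "mon (xs @ [x]) \<approx> \<dots>"
            using cong_trans 2(3) \<open>mon (xs @ [x]) \<approx> mon (normal_word \<alpha> w \<beta> @ [x])\<close> by blast
          moreover have "awalk u (\<alpha> @ [f]) (head G f)" "awalk (head G f) [] (head G f)"
            using walks f True by (auto simp: awalk_simps)
          ultimately show ?thesis by blast
        next
          case False
          then show ?thesis
            using cong_trans[OF step] normal_word_vertex_zero[OF walks, of "tail G f" "[x]"] Edge f v
            by auto
        qed
      next
        case (Cons e \<beta>')
        then have e: "e \<in> arcs G" "awalk (head G e) \<beta>' w" using walks by (auto simp: awalk_simps)
        note set' = set_normal_word[OF walks(1) e(2)]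
        have eq: "normal_word \<alpha> w \<beta> @ [x] = normal_word \<alpha> w \<beta>' @ [Ghost e, Edge f]"
          by (simp add: normal_word_def Cons Edge)
        show ?thesis
        proof (cases "e = f")
          case True
          have "mon (normal_word \<alpha> w \<beta> @ [x]) \<approx> mon (normal_word \<alpha> w \<beta>' @ [Vertex (head G e)])"
            using word_rules(6)[of e "normal_word \<alpha> w \<beta>'" "[]"] set' e True by (simp add: eq)
          also have "\<dots> \<approx> mon (normal_word \<alpha> w \<beta>')"
            using normal_word_vertex[OF walks(1) e(2), of "[]"] by simp
          finally show ?thesis using cong_trans[OF step] walks(1) e(2) by blast
        next
          case False
          then show ?thesis
            using word_zero_rules(2)[of e f "normal_word \<alpha> w \<beta>'" "[]"] set' e f
              cong_trans[OF step] by (auto simp: eq)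
        qed
      qed
    next
      case (Ghost f)
      then have f: "f \<in> arcs G" using snoc.prems by simp
      show ?thesis
      proof (cases "head G f = v")
        case True
        then have "awalk (tail G f) (f # \<beta>) w" using walks f by (simp add: awalk_simps)
        moreover have "normal_word \<alpha> w \<beta> @ [x] = normal_word \<alpha> w (f # \<beta>)"
          by (simp add: normal_word_def Ghost)
        ultimately show ?thesis using step walks(1) by metis
      next
        case False
        have "mon (normal_word \<alpha> w \<beta> @ [x]) \<approx> mon (normal_word \<alpha> w \<beta> @ [Vertex (head G f), x])"
          using word_rules(4)[of f "normal_word \<alpha> w \<beta>" "[]"] set f Ghost by (auto intro: cong_sym)
        also have "\<dots> \<approx> 0"
          using normal_word_vertex_zero[OF walks, of "head G f" "[x]"] False f Ghost by auto
        finally show ?thesis using cong_trans[OF step] by blast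
      qed
    qed
  qed
qed

text \<open>
  The edges of \<open>p\<close> and \<open>q\<close> cancel in pairs from the inside until the first disagreement, which
  gives zero.
\<close>

lemma ghost_walk_mult:
  assumes "set p \<subseteq> arcs G" "awalk u q w" "length p \<le> length q"
  shows "mon (map Ghost (rev p) @ map Edge q @ [Vertex w]) \<approx>
    (if prefix p q then mon (map Edge (drop (length p) q) @ [Vertex w]) else 0)"
  using assms
proof (induction p arbitrary: u q)
  case Nil
  then show ?case by simp
next
  case (Cons e p)
  then obtain f q' where q: "q = f # q'" by (cases q) auto
  have walk: "f \<in> arcs G" "awalk (head G f) q' w" "w \<in> verts G" "set q' \<subseteq> arcs G"
    using Cons.prems by (auto simp: q awalk_simps dest: awalk_last_in_verts awalk_arcs)
  have sets: "set (map Ghost (rev p)) \<subseteq> lpa_gens G" "set (map Edge q' @ [Vertex w]) \<subseteq> lpa_gens G"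
    using Cons.prems walk by auto
  show ?case
  proof (cases "e = f")
    case True
    have "mon (map Ghost (rev (e # p)) @ map Edge q @ [Vertex w]) \<approx>
        mon (map Ghost (rev p) @ Vertex (head G e) # map Edge q' @ [Vertex w])"
      using word_rules(6)[OF _ sets] walk True by (simp add: q)
    also have "\<dots> \<approx> mon (map Ghost (rev p) @ map Edge q' @ [Vertex w])"
      using edge_target[of "head G e" q' w, OF _ sets(1), of "[]"] walk True by simp
    also have "\<dots> \<approx> (if prefix p q' then mon (map Edge (drop (length p) q') @ [Vertex w]) else 0)"
      using Cons walk by (simp add: q)
    finally have "mon (map Ghost (rev (e # p)) @ map Edge q @ [Vertex w]) \<approx>
        (if prefix p q' then mon (map Edge (drop (length p) q') @ [Vertex w]) else 0)" .
    moreover have "prefix (e # p) q \<longleftrightarrow> prefix p q'" "drop (length (e # p)) q = drop (length p) q'"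
      by (simp_all add: q True)
    ultimately show ?thesis by (simp only:)
  next
    case False
    then show ?thesis
      using word_zero_rules(2)[OF _ _ _ sets, of e f] walk Cons.prems by (simp add: q)
  qed
qed

end


section \<open>Eliminating ghost edges\<close>

context lpa_ideal
begin

definition normal_words :: "nat \<Rightarrow> 'v \<Rightarrow> ('v, 'e) lpa_gen list set" where
  "normal_words N v =
    {normal_word \<alpha> w \<beta> | u \<alpha> w \<beta>. awalk u \<alpha> w \<and> awalk v \<beta> w \<and> length \<beta> \<le> N}"

definition path_words :: "('v, 'e) lpa_gen list set" where
  "path_words = {map Edge \<alpha> @ [Vertex w] | u \<alpha> w. awalk u \<alpha> w}"

lemma normal_words_source:
  assumes "k \<in> normal_words N v" "v' \<in> verts G"
  shows "mon k * mon [Vertex v'] \<approx> (if v' = v then mon k else 0)"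
proof -
  obtain u \<alpha> w \<beta> where "k = normal_word \<alpha> w \<beta>" "awalk u \<alpha> w" "awalk v \<beta> w"
    using assms by (auto simp: normal_words_def)
  then show ?thesis
    using normal_word_vertex[of u \<alpha> w v \<beta> "[]"] normal_word_vertex_zero[of u \<alpha> w v \<beta> v' "[]"] assms(2)
    by (auto simp: mon_append[symmetric])
qed

lemma normal_words_cases:
  assumes "k \<in> normal_words N v"
  obtains (real) u \<alpha> where "awalk u \<alpha> v" "k = map Edge \<alpha> @ [Vertex v]"
    | (ghost) e k' where "N \<noteq> 0" "e \<in> out_arcs G v" "k' \<in> normal_words (N - 1) (head G e)" "k = k' @ [Ghost e]"
proof -
  obtain u \<alpha> w \<beta> where k: "k = normal_word \<alpha> w \<beta>" "awalk u \<alpha> w" "awalk v \<beta> w" "length \<beta> \<le> N"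
    using assms by (auto simp: normal_words_def)
  show ?thesis
  proof (cases \<beta>)
    case Nil
    then have "awalk u \<alpha> v" "k = map Edge \<alpha> @ [Vertex v]"
      using k by (auto simp: awalk_simps normal_word_def)
    then show ?thesis by (rule real)
  next
    case (Cons e \<beta>')
    have "N \<noteq> 0" "e \<in> out_arcs G v" "awalk (head G e) \<beta>' w" "length \<beta>' \<le> N - 1"
      "k = normal_word \<alpha> w \<beta>' @ [Ghost e]"
      using k by (auto simp: awalk_simps normal_word_def Cons)
    moreover from this have "normal_word \<alpha> w \<beta>' \<in> normal_words (N - 1) (head G e)"
      using k(2) unfolding normal_words_def by blast
    ultimately show ?thesis by (intro ghost)
  qed
qed

lemma path_in_normal_words:
  "awalk u \<alpha> w \<Longrightarrow> map Edge \<alpha> @ [Vertex w] \<in> normal_words N w"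
proof -
  assume "awalk u \<alpha> w"
  moreover then have "awalk w [] w" by (auto simp: awalk_Nil_iff dest: awalk_last_in_verts)
  moreover have "map Edge \<alpha> @ [Vertex w] = normal_word \<alpha> w []" by (simp add: normal_word_def)
  moreover have "length ([] :: 'e list) \<le> N" by simp
  ultimately show ?thesis unfolding normal_words_def by blast
qed

lemma set_normal_words: "k \<in> normal_words N v \<Longrightarrow> set k \<subseteq> lpa_gens G"
  unfolding normal_words_def using set_normal_word by blast

text \<open>
  Congruence modulo \<open>R\<close> preserves membership in every larger ideal, so \<open>J\<close> can be studied by
  calculations modulo \<open>R\<close>.
\<close>

lemma cong_mem_superset:
  assumes "free_algebra_ideal (lpa_gens G) J" "R \<subseteq> J" "p \<approx> q"
  shows "p \<in> J \<longleftrightarrow> q \<in> J"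
proof -
  have "p - q \<in> J" using assms by (auto simp: cong_def)
  then show ?thesis
    using free_algebra_ideal.cong_mem[OF assms(1)] free_algebra_ideal.cong_def[OF assms(1)] by blast
qed

text \<open>
  Split \<open>a = b + \<Sum> c\<^sub>e e\<^sup>*\<close> into the part \<open>b\<close> without ghost edges and the parts whose ghost path
  begins with the edge \<open>e\<close>. Then \<open>a f\<close> is \<open>b f + c\<^sub>f\<close>, which has shorter ghost paths. If all
  these are in \<open>R\<close>, the vertex \<open>v\<close> cannot be regular, because \<open>a = \<Sum> a f f\<^sup>*\<close> would be in
  \<open>R\<close>. At a sink there are no ghost edges at all. At an infinite emitter there is an edge \<open>f\<close> with
  \<open>c\<^sub>f = 0\<close>, and then \<open>b f\<close> is a combination of paths that belongs to \<open>J\<close>; it is formally nonzero unless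
  \<open>b = 0\<close>, in which case all \<open>c\<^sub>e\<close>, and hence \<open>a\<close>, would be in \<open>R\<close>.
\<close>

lemma ghost_elimination_step:
  assumes J: "free_algebra_ideal (lpa_gens G) J" "R \<subseteq> J"
    and a: "a \<in> J" "a \<notin> R" and v: "v \<in> verts G"
    and sup: "supported (normal_words (Suc N) v) a"
  shows "(\<exists>b\<in>J. b \<noteq> 0 \<and> supported path_words b) \<or>
    (\<exists>c\<in>J. c \<notin> R \<and> supported (\<Union>v\<in>verts G. normal_words N v) c)"
proof -
  \<comment> \<open>On the words of \<open>a\<close>, these give \<open>b f\<close> in normal form and \<open>c\<^sub>f\<close>.\<close>
  define rw :: "'e \<Rightarrow> ('v, 'e) lpa_gen list \<Rightarrow> _ \<Rightarrow>\<^sub>0 'k" where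
    "rw f k = (if last k = Vertex v then mon (butlast k @ [Edge f, Vertex (head G f)]) else 0)" for f k
  define gw :: "'e \<Rightarrow> ('v, 'e) lpa_gen list \<Rightarrow> _ \<Rightarrow>\<^sub>0 'k" where
    "gw f k = (if last k = Ghost f then mon (butlast k) else 0)" for f k
  have keys: "letters w \<in> normal_words (Suc N) v" if "w \<in> Poly_Mapping.keys a" for w
    using supported_keys[OF sup that] .
  have edge: "a * mon [Edge f] \<approx> lin_ext (rw f) a + lin_ext (gw f) a" if f: "f \<in> out_arcs G v" for f
  proof -
    have "mon k * mon [Edge f] \<approx> rw f k + gw f k" if "k \<in> normal_words (Suc N) v" for k
      using that
    proof (cases rule: normal_words_cases)
      case (real u \<alpha>)
      have \<alpha>: "set \<alpha> \<subseteq> arcs G" using real(1) by (auto dest: awalk_arcs)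
      have "mon (map Edge \<alpha> @ [Vertex v, Edge f]) \<approx> mon (map Edge \<alpha> @ [Edge f])"
        using word_rules(2)[of f "map Edge \<alpha>" "[]"] \<alpha> f by auto
      also have "\<dots> \<approx> mon (map Edge \<alpha> @ [Edge f, Vertex (head G f)])"
        using word_rules(3)[of f "map Edge \<alpha>" "[]"] \<alpha> f by (auto intro: cong_sym)
      finally show ?thesis using real by (simp add: rw_def gw_def mon_append[symmetric])
    next
      case (ghost e k')
      note set = set_normal_words[OF ghost(3)]
      show ?thesis
      proof (cases "e = f")
        case True
        have "mon (k' @ [Ghost e, Edge f]) \<approx> mon (k' @ [Vertex (head G e)])"
          using word_rules(6)[of e k' "[]"] set f True by auto
        also have "\<dots> \<approx> mon k'"
          using normal_words_source[OF ghost(3), of "head G e"] ghost(2) by (simp add: mon_append[symmetric])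
        finally show ?thesis using ghost True by (simp add: rw_def gw_def mon_append[symmetric])
      next
        case False
        then have "mon (k' @ [Ghost e, Edge f]) \<approx> 0"
          using word_zero_rules(2)[of e f k' "[]"] set f ghost(2) by auto
        then show ?thesis using ghost False by (simp add: rw_def gw_def mon_append[symmetric])
      qed
    qed
    then have "lin_ext (\<lambda>k. mon k * mon [Edge f]) a \<approx> lin_ext (\<lambda>k. rw f k + gw f k) a"
      using keys by (intro cong_lin_ext) blast
    then show ?thesis by (simp add: lin_ext_mult_right lin_ext_add)
  qed
  have inJ: "lin_ext (rw f) a + lin_ext (gw f) a \<in> J" if "f \<in> out_arcs G v" for f
    using cong_mem_superset[OF J edge[OF that]] free_algebra_ideal.mult_mon(2)[OF J(1) a(1), of "[Edge f]"] that
    by simp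
  have sup_step: "supported (\<Union>v\<in>verts G. normal_words N v) (lin_ext (rw f) a + lin_ext (gw f) a)"
    if f: "f \<in> out_arcs G v" for f
  proof -
    have cases: "(rw f k = 0 \<or> (\<exists>k'\<in>normal_words N (head G f). rw f k = mon k')) \<and>
      (gw f k = 0 \<or> (\<exists>k'\<in>normal_words N (head G f). gw f k = mon k'))"
      if "k \<in> normal_words (Suc N) v" for k
      using that
    proof (cases rule: normal_words_cases)
      case (real u \<alpha>)
      then have "awalk u (\<alpha> @ [f]) (head G f)" using f by (auto simp: awalk_simps)
      from path_in_normal_words[OF this, of N] real show ?thesis
        by (auto simp: rw_def gw_def)
    qed (auto simp: rw_def gw_def)
    have supp: "supported (\<Union>v\<in>verts G. normal_words N v) p"
      if "p = 0 \<or> (\<exists>k'\<in>normal_words N (head G f). p = mon k')" for p :: "_ \<Rightarrow>\<^sub>0 'k"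
      using that
    proof (elim disjE bexE)
      fix k' assume "k' \<in> normal_words N (head G f)" "p = mon k'"
      moreover have "head G f \<in> verts G" using f by simp
      ultimately show ?thesis by auto
    qed simp
    have "supported (\<Union>v\<in>verts G. normal_words N v) (rw f (letters w))"
      "supported (\<Union>v\<in>verts G. normal_words N v) (gw f (letters w))"
      if "w \<in> Poly_Mapping.keys a" for w
      by (rule supp[OF cases[OF keys[OF that], THEN conjunct1]])
        (rule supp[OF cases[OF keys[OF that], THEN conjunct2]])
    then show ?thesis by (intro supported_add supported_lin_ext)
  qed
  show ?thesis
  proof (cases "\<exists>f\<in>out_arcs G v. lin_ext (rw f) a + lin_ext (gw f) a \<notin> R")
    case True
    then show ?thesis using inJ sup_step by blast
  next
    case False
    then have all: "lin_ext (rw f) a + lin_ext (gw f) a \<in> R" if "f \<in> out_arcs G v" for f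
      using that by blast
    have "\<not> regular_vertex G v"
    proof
      assume reg: "regular_vertex G v"
      have "mon k \<approx> mon k * mon [Vertex v]" if "k \<in> normal_words (Suc N) v" for k
        using normal_words_source[OF that v] by (auto intro: cong_sym)
      then have "lin_ext mon a \<approx> lin_ext (\<lambda>k. mon k * mon [Vertex v]) a"
        using keys by (intro cong_lin_ext) blast
      then have "a \<approx> a * mon [Vertex v]" by (simp add: lin_ext_mult_right)
      also have "a * mon [Vertex v] \<approx> a * (\<Sum>e\<in>out_arcs G v. mon [Edge e, Ghost e])"
      proof -
        have "supported {xs. set xs \<subseteq> lpa_gens G} a"
          using sup set_normal_words by (auto elim!: supported_mono)
        then show ?thesis
          using mult(1)[of "mon [Vertex v] - (\<Sum>e\<in>out_arcs G v. mon [Edge e, Ghost e])" a]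
            relation_mon(9)[OF reg] by (simp add: cong_def right_diff_distrib)
      qed
      also have "a * (\<Sum>e\<in>out_arcs G v. mon [Edge e, Ghost e]) \<approx> 0"
      proof -
        have "a * mon [Edge e] * mon [Ghost e] \<in> R" if "e \<in> out_arcs G v" for e
          using mult_mon(2)[of "a * mon [Edge e]" "[Ghost e]"] cong_mem[OF edge[OF that]] all[OF that] that
          by simp
        then show ?thesis
          unfolding cong_zero sum_distrib_left
          by (intro sum) (simp add: mon_append[of "[_]" "[_]", simplified] mult.assoc)
      qed
      finally show False using a(2) cong_zero by blast
    qed
    then have out: "out_arcs G v = {} \<or> infinite (out_arcs G v)"
      using v by (auto simp: regular_vertex_def)
    \<comment> \<open>The edges \<open>e\<close> for which \<open>c\<^sub>e\<close> occurs.\<close>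
    define F where "F = {e. Ghost e \<in> (\<lambda>w. last (letters w)) ` Poly_Mapping.keys a}"
    have finF: "finite F"
      unfolding F_def by (rule finite_vimageI[unfolded vimage_def]) (auto simp: inj_def)
    have outF: "F \<subseteq> out_arcs G v"
    proof
      fix e assume "e \<in> F"
      then obtain w where w: "w \<in> Poly_Mapping.keys a" "last (letters w) = Ghost e"
        by (auto simp: F_def)
      from keys[OF w(1)] w(2) show "e \<in> out_arcs G v"
        by (cases rule: normal_words_cases) auto
    qed
    show ?thesis
    proof (cases "\<exists>w\<in>Poly_Mapping.keys a. last (letters w) = Vertex v")
      case False
      have "rw e (letters w) = 0" if "w \<in> Poly_Mapping.keys a" for e w
        using False that by (auto simp: rw_def)
      then have rw0: "lin_ext (rw e) a = 0" for e
        by (simp add: lin_ext_def)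
      have "mon (letters w) = (\<Sum>e\<in>F. gw e (letters w) * mon [Ghost e])"
        if w: "w \<in> Poly_Mapping.keys a" for w
        using keys[OF w]
      proof (cases rule: normal_words_cases)
        case (real u \<alpha>)
        then show ?thesis using False w by force
      next
        case (ghost e k')
        then have "e \<in> F" using w by (force simp: F_def)
        have "gw f (letters w) * mon [Ghost f] = (if f = e then mon (letters w) else 0)" for f
          by (simp add: gw_def ghost(4) mon_append)
        then show ?thesis using finF \<open>e \<in> F\<close> by simp
      qed
      then have "lin_ext mon a = lin_ext (\<lambda>k. \<Sum>e\<in>F. gw e k * mon [Ghost e]) a"
        by (rule lin_ext_cong)
      then have "a = (\<Sum>e\<in>F. lin_ext (gw e) a * mon [Ghost e])"
        by (simp add: lin_ext_sum lin_ext_mult_right)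
      also have "\<dots> \<in> R"
        using all outF rw0 by (intro sum mult_mon) auto
      finally show ?thesis using a(2) by simp
    next
      case True
      then obtain w0 where w0: "w0 \<in> Poly_Mapping.keys a" "last (letters w0) = Vertex v"
        by blast
      from out show ?thesis
      proof
        assume empty: "out_arcs G v = {}"
        have "letters w \<in> path_words" if "w \<in> Poly_Mapping.keys a" for w
          using keys[OF that] empty by (cases rule: normal_words_cases) (auto simp: path_words_def)
        then have "supported path_words a" by (auto simp: supported_def)
        moreover have "a \<noteq> 0" using a(2) by auto
        ultimately show ?thesis using a(1) by blast
      next
        assume "infinite (out_arcs G v)"
        then obtain f where f: "f \<in> out_arcs G v" "f \<notin> F"
          using finF by (meson finite_subset subsetI)
        have "gw f (letters w) = 0" if "w \<in> Poly_Mapping.keys a" for w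
          using f(2) that by (force simp: F_def gw_def)
        then have "lin_ext (gw f) a = 0" by (simp add: lin_ext_def)
        then have "lin_ext (rw f) a \<in> J" using inJ[OF f(1)] by simp
        moreover have "supported path_words (lin_ext (rw f) a)"
        proof (rule supported_lin_ext)
          fix w assume "w \<in> Poly_Mapping.keys a"
          from keys[OF this] show "supported path_words (rw f (letters w))"
          proof (cases rule: normal_words_cases)
            case (real u \<alpha>)
            then have "awalk u (\<alpha> @ [f]) (head G f)" using f by (auto simp: awalk_simps)
            then have "map Edge (\<alpha> @ [f]) @ [Vertex (head G f)] \<in> path_words"
              unfolding path_words_def by blast
            then show ?thesis using real by (simp add: rw_def)
          qed (auto simp: rw_def)
        qed
        moreover have "lin_ext (rw f) a \<noteq> 0"
        proof
          \<comment> \<open>Appending \<open>f\<close> is injective on path words, so the coefficient of \<open>w0\<close> survives.\<close>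
          let ?w = "Word (butlast (letters w0) @ [Edge f, Vertex (head G f)])"
          assume "lin_ext (rw f) a = 0"
          then have "0 = Poly_Mapping.lookup (lin_ext (rw f) a) ?w" by simp
          also have "\<dots> = (\<Sum>w\<in>Poly_Mapping.keys a.
              if w = w0 then Poly_Mapping.lookup a w0 else 0)"
            unfolding lookup_lin_ext
          proof (intro sum.cong refl)
            fix w assume w: "w \<in> Poly_Mapping.keys a"
            have "w = w0" if "last (letters w) = Vertex v" "butlast (letters w) = butlast (letters w0)"
            proof -
              have "letters w \<noteq> []" "letters w0 \<noteq> []"
                using keys[OF w] keys[OF w0(1)] by (auto simp: normal_words_def normal_word_def)
              then have "letters w = letters w0"
                using that w0(2) by (metis append_butlast_last_id)
              then show ?thesis by (rule free_word.expand)
            qed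
            then show "Poly_Mapping.lookup a w * Poly_Mapping.lookup (rw f (letters w)) ?w =
                (if w = w0 then Poly_Mapping.lookup a w0 else 0)"
              using w0(2) by (auto simp: rw_def mon_def lookup_single when_def)
          qed
          also have "\<dots> = Poly_Mapping.lookup a w0" using w0(1) by simp
          finally show False using w0(1) by (simp add: in_keys_iff)
        qed
        ultimately show ?thesis by blast
      qed
    qed
  qed
qed

text \<open>
  Induction on the length of the ghost paths. The step works over a single vertex \<open>v\<close>, which is
  enough because \<open>a\<close> is congruent to the sum of its parts \<open>a v\<close>, and these are in \<open>J\<close>.
\<close>

lemma ghost_elimination:
  assumes J: "free_algebra_ideal (lpa_gens G) J" "R \<subseteq> J"
    and a: "a \<in> J" "a \<notin> R" "supported (\<Union>v\<in>verts G. normal_words N v) a"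
  shows "\<exists>b\<in>J. b \<noteq> 0 \<and> supported path_words b"
  using a
proof (induction N arbitrary: a)
  case 0
  have "normal_words 0 v \<subseteq> path_words" for v
    by (auto simp: path_words_def elim!: normal_words_cases)
  then have "supported path_words a" by (intro supported_mono[OF 0(3)] UN_least)
  moreover have "a \<noteq> 0" using 0(2) by auto
  ultimately show ?case using 0(1) by blast
next
  case (Suc N)
  have "\<exists>v\<in>verts G. letters w \<in> normal_words (Suc N) v" if "w \<in> Poly_Mapping.keys a" for w
    using supported_keys[OF Suc.prems(3) that] by blast
  then obtain src where src: "src w \<in> verts G" "letters w \<in> normal_words (Suc N) (src w)"
    if "w \<in> Poly_Mapping.keys a" for w
    by metis
  define V where "V = src ` Poly_Mapping.keys a"
  have V: "finite V" "V \<subseteq> verts G" using src by (auto simp: V_def)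
  define part where
    "part v = lin_ext (\<lambda>k. if k \<in> normal_words (Suc N) v then mon k else 0) a" for v
  have part: "a * mon [Vertex v] \<approx> part v" if v: "v \<in> verts G" for v
  proof -
    have "lin_ext (\<lambda>k. mon k * mon [Vertex v]) a \<approx> part v"
      unfolding part_def
    proof (rule cong_lin_ext)
      fix w assume w: "w \<in> Poly_Mapping.keys a"
      show "mon (letters w) * mon [Vertex v] \<approx>
          (if letters w \<in> normal_words (Suc N) v then mon (letters w) else 0)"
        using normal_words_source[OF _ v, of "letters w" "Suc N" v]
          normal_words_source[OF src(2)[OF w] v] src(2)[OF w]
        by (cases "v = src w") auto
    qed
    then show ?thesis by (simp add: lin_ext_mult_right)
  qed
  have "\<exists>v\<in>V. part v \<notin> R"
  proof (rule ccontr)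
    assume "\<not> ?thesis"
    then have "a * mon [Vertex v] \<in> R" if "v \<in> V" for v
      using that part cong_mem V(2) by blast
    then have "(\<Sum>v\<in>V. a * mon [Vertex v]) \<in> R" by (rule sum)
    moreover have "lin_ext (\<lambda>k. \<Sum>v\<in>V. mon k * mon [Vertex v]) a \<approx> lin_ext mon a"
    proof (rule cong_lin_ext)
      fix w assume w: "w \<in> Poly_Mapping.keys a"
      have "(\<Sum>v\<in>V. mon (letters w) * mon [Vertex v]) \<approx>
          (\<Sum>v\<in>V. if v = src w then mon (letters w) else 0)"
        using normal_words_source[OF src(2)[OF w]] V(2) by (intro cong_sum) blast
      also have "\<dots> = mon (letters w)"
        using V(1) w by (simp add: V_def)
      finally show "(\<Sum>v\<in>V. mon (letters w) * mon [Vertex v]) \<approx> mon (letters w)" .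
    qed
    ultimately have "a \<in> R"
      using cong_mem by (simp add: lin_ext_sum lin_ext_mult_right)
    then show False using Suc.prems by simp
  qed
  then obtain v where v: "v \<in> verts G" "part v \<notin> R" using V(2) by blast
  have "part v \<in> J"
    using cong_mem_superset[OF J part[OF v(1)]] free_algebra_ideal.mult_mon(2)[OF J(1) Suc.prems(1)] v(1)
    by simp
  moreover have "supported (normal_words (Suc N) v) (part v)"
    unfolding part_def by (intro supported_lin_ext) simp
  ultimately show ?case
    using ghost_elimination_step[OF J _ v(2,1)] Suc.IH by blast
qed

end


section \<open>Vertices in an ideal\<close>

context lpa_ideal
begin

text \<open>
  With a shortest path \<open>\<alpha>0\<close> of \<open>b\<close> and an escaping walk \<open>\<tau>\<close>, the compression
  \<open>(\<alpha>0 \<tau>)\<^sup>* u0 \<alpha> v \<tau>\<close> is the vertex \<open>x\<close> for \<open>\<alpha> = \<alpha>0\<close> and zero for every other path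
  \<open>\<alpha>\<close> of \<open>b\<close>: it can only be nonzero if \<open>\<alpha> = \<alpha>0 \<gamma>\<close> with a closed walk \<open>\<gamma>\<close> and \<open>\<tau>\<close> is a prefix
  of \<open>\<gamma> \<tau>\<close>.
\<close>

lemma vertex_in_ideal:
  assumes L: "condition_L G" and b: "b \<in> R" "b \<noteq> 0" "supported path_words b"
  shows "\<exists>x\<in>verts G. mon [Vertex x] \<in> R"
proof -
  obtain w1 where "w1 \<in> Poly_Mapping.keys b" using b(2) by (metis ex_in_conv keys_eq_empty)
  from ex_has_least_nat[of "\<lambda>w. w \<in> Poly_Mapping.keys b", OF this, of "\<lambda>w. length (letters w)"]
  obtain w0 where w0: "w0 \<in> Poly_Mapping.keys b"
    and least: "\<And>w. w \<in> Poly_Mapping.keys b \<Longrightarrow> length (letters w0) \<le> length (letters w)"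
    by blast
  obtain u0 \<alpha>0 v where \<alpha>0: "awalk u0 \<alpha>0 v" "letters w0 = map Edge \<alpha>0 @ [Vertex v]"
    using supported_keys[OF b(3) w0] by (auto simp: path_words_def)
  have v: "v \<in> verts G" using \<alpha>0 by (auto dest: awalk_last_in_verts)
  define \<Gamma> where "\<Gamma> = {\<gamma>. \<gamma> \<noteq> [] \<and> awalk v \<gamma> v \<and>
    Word (map Edge (\<alpha>0 @ \<gamma>) @ [Vertex v]) \<in> Poly_Mapping.keys b}"
  have "finite ((\<lambda>\<gamma>. Word (map Edge (\<alpha>0 @ \<gamma>) @ [Vertex v])) -` Poly_Mapping.keys b)"
    by (rule finite_vimageI) (auto simp: inj_def inj_map_eq_map[of Edge])
  then have "finite \<Gamma>" by (rule rev_finite_subset) (auto simp: \<Gamma>_def)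
  from walk_escaping_closed_walks[OF L v this]
  obtain \<tau> x where \<tau>: "awalk v \<tau> x" "\<And>\<gamma>. \<gamma> \<in> \<Gamma> \<Longrightarrow> \<not> prefix \<tau> (\<gamma> @ \<tau>)"
    by (auto simp: \<Gamma>_def)
  have x: "x \<in> verts G" using \<tau> by (auto dest: awalk_last_in_verts)
  \<comment> \<open>The factor \<open>u0\<close> matters if \<open>\<alpha>0\<close> is empty: it removes the paths that start elsewhere.\<close>
  let ?g = "map Ghost (rev (\<alpha>0 @ \<tau>))"
  let ?l = "?g @ [Vertex u0]" and ?r = "Vertex v # map Edge \<tau> @ [Vertex x]"
  have arcs: "set \<alpha>0 \<subseteq> arcs G" "set \<tau> \<subseteq> arcs G" using \<alpha>0 \<tau> by (auto dest: awalk_arcs)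
  have u0: "u0 \<in> verts G" using \<alpha>0 by (auto dest: awalk_hd_in_verts)
  have lr: "set ?l \<subseteq> lpa_gens G" "set ?r \<subseteq> lpa_gens G"
    using arcs v x u0 by auto
  have *: "mon ?l * mon (letters w) * mon ?r \<approx> (if letters w = letters w0 then mon [Vertex x] else 0)"
    if w: "w \<in> Poly_Mapping.keys b" for w
  proof -
    obtain u \<alpha> v' where \<alpha>: "awalk u \<alpha> v'" "letters w = map Edge \<alpha> @ [Vertex v']"
      using supported_keys[OF b(3) w] by (auto simp: path_words_def)
    have v': "v' \<in> verts G" and "set \<alpha> \<subseteq> arcs G" using \<alpha> by (auto dest: awalk_last_in_verts awalk_arcs)
    have eq: "mon ?l * mon (letters w) * mon ?r =
        mon ((?g @ [Vertex u0] @ map Edge \<alpha> @ [Vertex v']) @ ?r)"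
      by (simp add: \<alpha> mon_append[symmetric])
    have g: "set ?g \<subseteq> lpa_gens G" and r: "set ?r \<subseteq> lpa_gens G" using lr by auto
    consider "u \<noteq> u0" | "u = u0" "v' \<noteq> v" | "u = u0" "v' = v" by blast
    then show ?thesis
    proof cases
      case 1
      have u: "u \<in> verts G" using \<alpha> by (auto dest: awalk_hd_in_verts)
      have "mon ((?g @ [Vertex u0]) @ map Edge \<alpha> @ Vertex v' # ?r) \<approx>
          mon ((?g @ [Vertex u0]) @ Vertex u # map Edge \<alpha> @ Vertex v' # ?r)"
        using g r u0 by (intro cong_sym[OF edge_target[OF \<alpha>(1)]]) auto
      also have "\<dots> \<approx> 0"
        using word_zero_rules(1)[OF u0 u, of ?g "map Edge \<alpha> @ Vertex v' # ?r"]
          g r v' 1 \<open>set \<alpha> \<subseteq> arcs G\<close> by simp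
      finally have "mon ((?g @ [Vertex u0] @ map Edge \<alpha> @ [Vertex v']) @ ?r) \<approx> 0" by simp
      moreover have "letters w \<noteq> letters w0"
      proof
        assume "letters w = letters w0"
        then have "\<alpha> = \<alpha>0" "v' = v" by (auto simp: \<alpha> \<alpha>0 inj_map_eq_map inj_def)
        then show False using 1 \<alpha>(1) \<alpha>0(1) by (cases \<alpha>) (auto simp: awalk_simps)
      qed
      ultimately show ?thesis unfolding eq by simp
    next
      case 2
      have "mon ((?g @ [Vertex u0] @ map Edge \<alpha> @ [Vertex v']) @ ?r) \<approx> 0"
        using word_zero_rules(1)[OF v' v 2(2), of "?g @ [Vertex u0] @ map Edge \<alpha>" "map Edge \<tau> @ [Vertex x]"]
          arcs \<open>set \<alpha> \<subseteq> arcs G\<close> x u0 by simp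
      then show ?thesis unfolding eq using 2 by (simp add: \<alpha> \<alpha>0)
    next
      case 3
      have len: "length \<alpha>0 \<le> length \<alpha>" using least[OF w] by (simp add: \<alpha> \<alpha>0)
      have walk: "awalk u (\<alpha> @ \<tau>) x" using \<alpha>(1) \<tau>(1) 3 by (metis awalk_appendI)
      have "mon (?g @ Vertex u # map Edge \<alpha> @ Vertex v' # ?r) \<approx> mon (?g @ map Edge \<alpha> @ Vertex v' # ?r)"
        by (rule edge_target[OF \<alpha>(1) g r])
      also have "\<dots> \<approx> mon ((?g @ map Edge \<alpha>) @ Vertex v # map Edge \<tau> @ Vertex x # [])"
        using word_rules(1)[OF v, of "?g @ map Edge \<alpha>" "map Edge \<tau> @ [Vertex x]"]
          arcs \<open>set \<alpha> \<subseteq> arcs G\<close> x 3 by simp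
      also have "\<dots> \<approx> mon ((?g @ map Edge \<alpha>) @ map Edge \<tau> @ Vertex x # [])"
        using arcs \<open>set \<alpha> \<subseteq> arcs G\<close> by (intro edge_target[OF \<tau>(1)]) auto
      also have "\<dots> = mon (?g @ map Edge (\<alpha> @ \<tau>) @ [Vertex x])" by simp
      also have "\<dots> \<approx> (if prefix (\<alpha>0 @ \<tau>) (\<alpha> @ \<tau>)
          then mon (map Edge (drop (length (\<alpha>0 @ \<tau>)) (\<alpha> @ \<tau>)) @ [Vertex x]) else 0)"
        using arcs walk len by (intro ghost_walk_mult[where u = u]) auto
      also have "\<dots> = (if letters w = letters w0 then mon [Vertex x] else 0)"
      proof (cases "\<alpha> = \<alpha>0")
        case False
        have "\<not> prefix (\<alpha>0 @ \<tau>) (\<alpha> @ \<tau>)"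
        proof
          assume p: "prefix (\<alpha>0 @ \<tau>) (\<alpha> @ \<tau>)"
          then have "prefix \<alpha>0 \<alpha>"
            using len by (metis append_prefixD prefix_length_prefix prefixI)
          then obtain \<gamma> where \<gamma>: "\<alpha> = \<alpha>0 @ \<gamma>" by (auto simp: prefix_def)
          moreover obtain y where "awalk u0 \<alpha>0 y" "awalk y \<gamma> v"
            using \<alpha>(1) 3 \<gamma> by auto
          ultimately have "awalk v \<gamma> v" using \<alpha>0(1) awalk_ends by blast
          moreover have "Word (map Edge (\<alpha>0 @ \<gamma>) @ [Vertex v]) = w"
            using \<alpha>(2) 3 \<gamma> by (cases w) simp
          ultimately have "\<gamma> \<in> \<Gamma>" using False \<gamma> w by (auto simp: \<Gamma>_def)
          then show False using \<tau>(2) p \<gamma> by simp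
        qed
        then show ?thesis using False by (simp add: \<alpha> \<alpha>0 inj_map_eq_map inj_def)
      qed (simp add: \<alpha> \<alpha>0 3)
      finally show ?thesis unfolding eq using 3 by simp
    qed
  qed
  let ?c = "Poly_Mapping.lookup b w0"
  have in_R: "mon ?l * b * mon ?r \<in> R"
    by (rule mult_mon(2)[OF mult_mon(1)[OF b(1) lr(1)] lr(2)])
  have cong: "lin_ext (\<lambda>k. mon ?l * mon k * mon ?r) b \<approx>
      lin_ext (\<lambda>k. if k = letters w0 then mon [Vertex x] else 0) b"
    using * by (rule cong_lin_ext)
  have lhs: "lin_ext (\<lambda>k. mon ?l * mon k * mon ?r) b = mon ?l * b * mon ?r"
    by (simp only: lin_ext_mult_right lin_ext_mult_left lin_ext_mon)
  have rhs: "lin_ext (\<lambda>k. if k = letters w0 then mon [Vertex x] else 0) b = scalar ?c * mon [Vertex x]"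
  proof -
    have "letters w = letters w0 \<longleftrightarrow> w = w0" for w by (auto intro: free_word.expand)
    then show ?thesis using w0 by (simp add: lin_ext_def if_distrib[of "(*) _"] cong: if_cong)
  qed
  have "scalar ?c * mon [Vertex x] \<in> R" 
    by (rule cong_mem[THEN iffD1, OF cong[unfolded lhs rhs] in_R])
  from scale[OF this, of "1 / ?c"] have "mon [Vertex x] \<in> R"
    using w0 by (simp add: mult.assoc[symmetric] mult_single in_keys_iff)
  then show ?thesis using x by blast
qed

text \<open>
  If \<open>s(e)\<close> is in the ideal, then so is \<open>e\<^sup>* s(e) e = r(e)\<close>.
\<close>

lemma ideal_vertices_hereditary: "hereditary G {v \<in> verts G. mon [Vertex v] \<in> R}"
  unfolding hereditary_def
proof (intro conjI ballI impI)
  fix e assume e: "e \<in> arcs G" "tail G e \<in> {v \<in> verts G. mon [Vertex v] \<in> R}"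
  then have "mon [Ghost e] * mon [Vertex (tail G e)] * mon [Edge e] \<in> R"
    by (intro mult_mon) auto
  moreover have "mon [Ghost e] * mon [Vertex (tail G e)] * mon [Edge e] \<approx> mon [Ghost e, Edge e]"
    using word_rules(2)[of e "[Ghost e]" "[]"] e by (simp add: mon_append[symmetric])
  moreover have "mon [Ghost e, Edge e] \<approx> mon [Vertex (head G e)]"
    using relation_mon(7) e by blast
  ultimately show "head G e \<in> {v \<in> verts G. mon [Vertex v] \<in> R}"
    using cong_mem e by auto
qed auto

text \<open>
  At a regular vertex, \<open>v = \<Sum> e r(e) e\<^sup>*\<close>.
\<close>

lemma ideal_vertices_saturated: "saturated G {v \<in> verts G. mon [Vertex v] \<in> R}"
  unfolding saturated_def
proof (intro allI impI)
  fix v assume v: "regular_vertex G v \<and> head G ` out_arcs G v \<subseteq> {v \<in> verts G. mon [Vertex v] \<in> R}"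
  have "mon [Edge e, Ghost e] \<in> R" if e: "e \<in> out_arcs G v" for e
  proof -
    have "mon [Edge e] * mon [Vertex (head G e)] * mon [Ghost e] \<in> R"
    proof (intro mult_mon)
      show "mon [Vertex (head G e)] \<in> R" using v e by blast
    qed (use e in auto)
    moreover have "mon [Edge e] * mon [Vertex (head G e)] * mon [Ghost e] \<approx> mon [Edge e, Ghost e]"
      using word_rules(3)[of e "[]" "[Ghost e]"] e by (simp add: mon_append[symmetric])
    ultimately show ?thesis using cong_mem by blast
  qed
  then have "(\<Sum>e\<in>out_arcs G v. mon [Edge e, Ghost e]) \<in> R" by (rule sum)
  then show "v \<in> {v \<in> verts G. mon [Vertex v] \<in> R}"
    using relation_mon(9) cong_mem v by (auto simp: regular_vertex_def)
qed

lemma ideal_eq_carrier: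
  assumes "{v \<in> verts G. mon [Vertex v] \<in> R} = verts G"
  shows "R = Carrier (free_algebra (lpa_gens G))"
proof
  have vertex: "mon [Vertex v] \<in> R" if "v \<in> verts G" for v using assms that by blast
  have letter: "mon [x] \<in> R" if "x \<in> lpa_gens G" for x
  proof (cases x)
    case (Vertex v)
    then show ?thesis using that vertex by simp
  next
    case (Edge e)
    then have "mon [Vertex (tail G e)] * mon [Edge e] \<in> R" 
      using that by (intro mult_mon vertex) auto
    then show ?thesis using relation_mon(3)[of e] cong_mem Edge that by (simp add: mon_append[symmetric])
  next
    case (Ghost e)
    then have "mon [Vertex (head G e)] * mon [Ghost e] \<in> R" 
      using that by (intro mult_mon vertex) auto
    then show ?thesis using relation_mon(5)[of e] cong_mem Ghost that by (simp add: mon_append[symmetric])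
  qed
  show "Carrier (free_algebra (lpa_gens G)) \<subseteq> R"
  proof
    fix p :: "('v, 'e) lpa_gen free_word \<Rightarrow>\<^sub>0 'k"
    assume p: "p \<in> Carrier (free_algebra (lpa_gens G))"
    have "mon (letters w) \<in> R" if w: "w \<in> Poly_Mapping.keys p" for w
    proof -
      obtain x xs where "letters w = x # xs" "x \<in> lpa_gens G" "set xs \<subseteq> lpa_gens G"
        using supported_keys[OF p[unfolded in_free_algebra] w] by (cases "letters w") auto
      then show ?thesis
        using mult_mon(2)[OF letter, of x xs] by (simp add: mon_append[symmetric])
    qed
    then have "lin_ext mon p \<in> R" by (rule lin_ext_mem)
    then show "p \<in> R" by simp
  qed
qed (use carrier in blast)

text \<open>
  An ideal that properly contains \<open>R\<close> contains a vertex, and the vertices that it contains form a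
  hereditary saturated set.
\<close>

lemma larger_ideal_eq_carrier:
  assumes L: "condition_L G" and H: "\<And>H. hereditary G H \<Longrightarrow> saturated G H \<Longrightarrow> H = {} \<or> H = verts G"
    and J: "algebra_ideal (free_algebra (lpa_gens G)) J" "R \<subseteq> J" "J \<noteq> R"
  shows "J = Carrier (free_algebra (lpa_gens G))"
proof -
  have J': "free_algebra_ideal (lpa_gens G) J" using J(1) by (rule free_algebra_ideal.intro)
  have J'': "lpa_ideal G J" 
    using J' J(2) relations by (intro lpa_ideal.intro lpa_ideal_axioms.intro wf_digraph_axioms) auto
  obtain a where a: "a \<in> J" "a \<notin> R" using J(2,3) by blast
  have "\<exists>q. (q = 0 \<or> (\<exists>v\<in>verts G. \<exists>N. \<exists>k\<in>normal_words N v. q = mon k)) \<and> mon xs \<approx> q"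
    if xs: "xs \<noteq> []" "set xs \<subseteq> lpa_gens G" for xs
    using word_normal_form[OF xs]
  proof (elim disjE exE conjE)
    fix u v \<alpha> w \<beta> assume *: "awalk u \<alpha> w" "awalk v \<beta> w" "mon xs \<approx> mon (normal_word \<alpha> w \<beta>)"
    then have "normal_word \<alpha> w \<beta> \<in> normal_words (length \<beta>) v" "v \<in> verts G"
      unfolding normal_words_def by (blast, blast dest: awalk_hd_in_verts)
    then show ?thesis using *(3) by blast
  qed blast
  then obtain nf where nf: "mon xs \<approx> nf xs"
      "nf xs = 0 \<or> (\<exists>v\<in>verts G. \<exists>N. \<exists>k\<in>normal_words N v. nf xs = mon k)"
    if "xs \<noteq> []" "set xs \<subseteq> lpa_gens G" for xs
    by metis
  have nf_mono: "normal_words M v \<subseteq> normal_words N v" if "M \<le> N" for M N v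
    using that unfolding normal_words_def by (blast intro: order.trans)
  have keys: "letters w \<noteq> []" "set (letters w) \<subseteq> lpa_gens G" if "w \<in> Poly_Mapping.keys a" for w
    using supported_keys[of _ a, OF _ that] free_algebra_ideal.carrier[OF J' a(1)]
    by (auto simp: in_free_algebra)
  have "\<exists>N. supported (\<Union>v\<in>verts G. normal_words N v) (nf (letters w))"
    if "w \<in> Poly_Mapping.keys a" for w
    using nf(2)[OF keys[OF that]]
  proof (elim disjE bexE exE)
    fix v N k assume "v \<in> verts G" "k \<in> normal_words N v" "nf (letters w) = mon k"
    then have "supported (\<Union>v\<in>verts G. normal_words N v) (nf (letters w))" by auto
    then show ?thesis by blast
  qed simp
  then obtain N where N: "supported (\<Union>v\<in>verts G. normal_words (N w) v) (nf (letters w))"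
    if "w \<in> Poly_Mapping.keys a" for w
    by metis
  define M where "M = Max (N ` Poly_Mapping.keys a)"
  have "supported (\<Union>v\<in>verts G. normal_words M v) (lin_ext nf a)"
  proof (rule supported_lin_ext)
    fix w assume w: "w \<in> Poly_Mapping.keys a"
    then have "N w \<le> M" by (simp add: M_def)
    then show "supported (\<Union>v\<in>verts G. normal_words M v) (nf (letters w))"
      using nf_mono by (intro supported_mono[OF N[OF w]]) blast
  qed
  moreover have "lin_ext mon a \<approx> lin_ext nf a"
    using nf(1) keys by (intro cong_lin_ext) blast
  then have "a \<approx> lin_ext nf a" by simp
  moreover from this have "lin_ext nf a \<in> J" "lin_ext nf a \<notin> R"
    using cong_mem_superset[OF J' J(2)] cong_mem a by blast+
  ultimately obtain b where "b \<in> J" "b \<noteq> 0" "supported path_words b"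
    using ghost_elimination[OF J' J(2)] by blast
  then obtain x where "x \<in> verts G" "mon [Vertex x] \<in> J"
    using lpa_ideal.vertex_in_ideal[OF J'' L] by blast
  then have "{v \<in> verts G. mon [Vertex v] \<in> J} = verts G"
    using H[OF lpa_ideal.ideal_vertices_hereditary[OF J''] lpa_ideal.ideal_vertices_saturated[OF J'']]
    by blast
  then show ?thesis by (rule lpa_ideal.ideal_eq_carrier[OF J''])
qed

end


section \<open>Actions by partial injections and their kernels\<close>

text \<open>
  Words act on the left, so the last letter acts first; \<open>None\<close> stands for the zero vector.
\<close>

fun word_action :: "('x \<Rightarrow> 's \<Rightarrow> 's option) \<Rightarrow> 'x list \<Rightarrow> 's \<Rightarrow> 's option" where
  "word_action act [] s = Some s"
| "word_action act (x # xs) s = Option.bind (word_action act xs s) (act x)"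

lemma word_action_append:
  "word_action act (xs @ ys) s = Option.bind (word_action act ys s) (word_action act xs)"
  by (induction xs) (auto split: Option.bind_split)

definition matrix_entry :: "('x \<Rightarrow> 's \<Rightarrow> 's option) \<Rightarrow> 's \<Rightarrow> 's \<Rightarrow> 'x list \<Rightarrow> 'k::field" where
  "matrix_entry act s t xs = (if word_action act xs s = Some t then 1 else 0)"

text \<open>
  Letting each letter move or kill the basis vectors defines a representation of the free algebra on the
  space with basis \<open>'s\<close>; its kernel consists of the elements whose matrix entries all vanish.
\<close>

definition action_kernel ::
    "'x set \<Rightarrow> ('x \<Rightarrow> 's \<Rightarrow> 's option) \<Rightarrow> ('x free_word \<Rightarrow>\<^sub>0 'k::field) set" where
  "action_kernel X act =
    {p \<in> Carrier (free_algebra X). \<forall>s t. lin_form (matrix_entry act s t) p = 0}"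

text \<open>
  Since words act by partial injections, a matrix entry of \<open>xs @ ys\<close> is, for fixed \<open>xs\<close>, either
  zero or a single matrix entry of \<open>ys\<close>; similarly for fixed \<open>ys\<close>. This replaces the sum over
  intermediate basis vectors in a matrix product.
\<close>

lemma algebra_ideal_action_kernel:
  assumes inj: "\<And>x s s' t. act x s = Some t \<Longrightarrow> act x s' = Some t \<Longrightarrow> s = s'"
  shows "algebra_ideal (free_algebra X) (action_kernel X act :: ('x free_word \<Rightarrow>\<^sub>0 'k::field) set)"
proof -
  interpret F: k_algebra "free_algebra X :: ('k, _) algebra" by (rule k_algebra_free)
  have word_inj: "s = s'" if "word_action act xs s = Some t" "word_action act xs s' = Some t" for xs s s' t
    using that
  proof (induction xs arbitrary: t)
    case (Cons x xs)
    then show ?case using inj by (auto split: Option.bind_splits) 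
  qed simp
  have left: "lin_form (matrix_entry act s t) (q * p) = 0" if p: "\<And>s t. lin_form (matrix_entry act s t) p = 0"
    for s t and p q :: "'x free_word \<Rightarrow>\<^sub>0 'k"
  proof -
    have "lin_form (\<lambda>ys. matrix_entry act s t (xs @ ys)) p = 0" for xs
    proof (cases "\<exists>r. word_action act xs r = Some t")
      case True
      then obtain r where "word_action act xs r = Some t" by blast
      then have "(\<lambda>ys. matrix_entry act s t (xs @ ys)) = (matrix_entry act s r :: _ \<Rightarrow> 'k)"
        by (auto simp: matrix_entry_def word_action_append fun_eq_iff split: Option.bind_splits
            dest: word_inj)
      then show ?thesis using p by simp
    next
      case False
      then have "(\<lambda>ys. matrix_entry act s t (xs @ ys)) = (\<lambda>ys. 0 :: 'k)"
        by (auto simp: matrix_entry_def word_action_append fun_eq_iff split: Option.bind_splits)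
      then show ?thesis by simp
    qed
    then show ?thesis by (simp add: lin_form_mult_left)
  qed
  have right: "lin_form (matrix_entry act s t) (p * q) = 0" if p: "\<And>s t. lin_form (matrix_entry act s t) p = 0"
    for s t and p q :: "'x free_word \<Rightarrow>\<^sub>0 'k"
  proof -
    have "lin_form (\<lambda>xs. matrix_entry act s t (xs @ ys)) p = 0" for ys
    proof (cases "word_action act ys s")
      case None
      then have "(\<lambda>xs. matrix_entry act s t (xs @ ys)) = (\<lambda>xs. 0 :: 'k)"
        by (auto simp: matrix_entry_def word_action_append fun_eq_iff)
      then show ?thesis by simp
    next
      case (Some r)
      then have "(\<lambda>xs. matrix_entry act s t (xs @ ys)) = (matrix_entry act r t :: _ \<Rightarrow> 'k)"
        by (auto simp: matrix_entry_def word_action_append fun_eq_iff)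
      then show ?thesis using p by simp
    qed
    then show ?thesis by (simp add: lin_form_mult_left) (subst lin_form_swap, simp)
  qed
  show ?thesis
    using F.zero_closed F.add_closed F.scale_closed F.mult_closed left right
    by (auto simp: algebra_ideal_def action_kernel_def free_algebra_simps lin_form_add lin_form_scalar)
qed

lemma diff_in_action_kernel:
  fixes X :: "'x set"
  assumes "(mon xs :: _ \<Rightarrow>\<^sub>0 'k::field) \<in> Carrier (free_algebra X)" "(mon ys :: _ \<Rightarrow>\<^sub>0 'k) \<in> Carrier (free_algebra X)"
    and "\<And>s. word_action act xs s = word_action act ys s"
  shows "(mon xs - mon ys :: _ \<Rightarrow>\<^sub>0 'k) \<in> action_kernel X act"
  using assms free_algebra_diff[OF assms(1,2)]
  by (simp add: action_kernel_def lin_form_diff matrix_entry_def)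

lemma mon_in_action_kernel:
  assumes "(mon xs :: _ \<Rightarrow>\<^sub>0 'k::field) \<in> Carrier (free_algebra X)"
  shows "(mon xs :: _ \<Rightarrow>\<^sub>0 'k) \<in> action_kernel X act \<longleftrightarrow> (\<forall>s. word_action act xs s = None)"
  using assms by (simp add: action_kernel_def matrix_entry_def)

section \<open>Branching systems of a graph\<close>

text \<open>
  The arcs that lead outside \<open>H\<close> are the arcs of the quotient graph. The last
  coordinate of a basis vector over \<open>v\<close> ranges over \<open>\<nat>\<close>, and \<open>index v\<close> distributes these numbers
  bijectively over the pairs of a number and an arc that leaves \<open>v\<close> in the quotient graph. If there is only one such arc, \<open>index v\<close> is the identity on \<open>\<nat>\<close>, so that on a closed
  walk without exits nothing but the integer coordinate moves.
\<close>

locale branching = wf_digraph G for G :: "('v, 'e) pre_digraph" +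
  fixes H :: "'v set" and \<delta> :: int
  assumes countable_arcs: "countable (arcs G)"
    and hereditary: "hereditary G H" and saturated: "saturated G H"
begin

definition live_arcs :: "'v \<Rightarrow> 'e set" where
  "live_arcs v = {e \<in> out_arcs G v. head G e \<notin> H}"

definition index :: "'v \<Rightarrow> 'e \<times> nat \<Rightarrow> nat" where
  "index v = (if \<exists>e. live_arcs v = {e} then snd else to_nat_on (live_arcs v \<times> UNIV))"

lemma bij_index:
  assumes "live_arcs v \<noteq> {}"
  shows "bij_betw (index v) (live_arcs v \<times> UNIV) UNIV"
proof (cases "\<exists>e. live_arcs v = {e}")
  case True
  then show ?thesis by (auto simp: index_def bij_betw_def inj_on_def image_def)
next
  case False
  have "countable (live_arcs v)"
    using countable_arcs by (rule countable_subset[rotated]) (auto simp: live_arcs_def)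
  moreover have "infinite (live_arcs v \<times> (UNIV :: nat set))"
    using assms by (simp add: finite_cartesian_product_iff)
  ultimately show ?thesis using False
    unfolding index_def by (simp add: to_nat_on_infinite)
qed

fun edge_action :: "'e \<Rightarrow> 'v \<times> int \<times> nat \<Rightarrow> ('v \<times> int \<times> nat) option" where
  "edge_action e (u, d, n) =
    (if e \<in> arcs G \<and> u = head G e \<and> u \<notin> H then Some (tail G e, d + \<delta>, index (tail G e) (e, n)) else None)"

fun gen_action :: "('v, 'e) lpa_gen \<Rightarrow> 'v \<times> int \<times> nat \<Rightarrow> ('v \<times> int \<times> nat) option" where
  "gen_action (Vertex v) s = (if fst s = v \<and> v \<in> verts G - H then Some s else None)"
| "gen_action (Edge e) s = edge_action e s"
| "gen_action (Ghost e) s =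
    (if \<exists>t. edge_action e t = Some s then Some (SOME t. edge_action e t = Some s) else None)"

text \<open>
  Most of what follows uses only the injectivity of the edge actions and the end vertices of the
  arcs, so basis vectors are handled as units.
\<close>

declare edge_action.simps [simp del] split_paired_Ex [simp del] split_paired_All [simp del]

lemma edge_action_inj:
  assumes "edge_action e s = Some r" "edge_action f t = Some r"
  shows "e = f \<and> s = t"
proof -
  obtain u d n where s: "s = (u, d, n)" by (cases s)
  obtain u' d' n' where t: "t = (u', d', n')" by (cases t)
  have *: "e \<in> live_arcs (tail G e)" "f \<in> live_arcs (tail G e)" "u = head G e" "u' = head G f" "d = d'"
    "index (tail G e) (e, n) = index (tail G e) (f, n')"
    using assms by (auto simp: s t live_arcs_def edge_action.simps split: if_splits)
  then have "(e, n) = (f, n')"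
    using bij_betw_imp_inj_on[OF bij_index, of "tail G e"] by (auto simp: inj_on_def)
  then show ?thesis using * by (simp add: s t)
qed

text \<open>
  A ghost edge acts as the inverse partial injection of its edge.
\<close>

lemma ghost_action_iff: "gen_action (Ghost e) s = Some t \<longleftrightarrow> edge_action e t = Some s"
proof
  assume "edge_action e t = Some s"
  moreover then have "(SOME t. edge_action e t = Some s) = t"
    using edge_action_inj by (intro some_equality) blast+
  ultimately show "gen_action (Ghost e) s = Some t" by auto
next
  assume "gen_action (Ghost e) s = Some t"
  then have ex: "\<exists>t. edge_action e t = Some s" and eq: "t = (SOME t. edge_action e t = Some s)"
    by (auto split: if_splits)
  show "edge_action e t = Some s" by (subst eq) (rule someI_ex[OF ex])
qed

declare gen_action.simps(3) [simp del]

lemma edge_action_SomeD: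
  assumes "edge_action e s = Some t"
  shows "e \<in> arcs G" "fst s = head G e" "fst t = tail G e" "head G e \<notin> H" "tail G e \<notin> H"
  using assms hereditary by (cases s; auto simp: hereditary_def edge_action.simps split: if_splits)+

lemma edge_action_range:
  assumes "v \<in> verts G - H" "live_arcs v \<noteq> {}"
  shows "\<exists>e\<in>out_arcs G v. \<exists>t. edge_action e t = Some (v, d, n)"
proof -
  have "n \<in> index v ` (live_arcs v \<times> UNIV)"
    using bij_betw_imp_surj_on[OF bij_index[OF assms(2)]] by simp
  then obtain e m where "e \<in> live_arcs v" "index v (e, m) = n" by auto
  then have "e \<in> out_arcs G v" "edge_action e (head G e, d - \<delta>, m) = Some (v, d, n)"
    by (auto simp: live_arcs_def edge_action.simps)
  then show ?thesis by blast
qed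

lemma gen_action_inj: "gen_action x s = Some t \<Longrightarrow> gen_action x s' = Some t \<Longrightarrow> s = s'"
  using edge_action_inj by (cases x) (auto simp: ghost_action_iff split: if_splits)

abbreviation kernel :: "(('v, 'e) lpa_gen free_word \<Rightarrow>\<^sub>0 'k::field) set" where
  "kernel \<equiv> action_kernel (lpa_gens G) gen_action"

lemma mon_carrier: "xs \<noteq> [] \<Longrightarrow> set xs \<subseteq> lpa_gens G \<Longrightarrow>
  (mon xs :: _ \<Rightarrow>\<^sub>0 'k::field) \<in> Carrier (free_algebra (lpa_gens G))"
  by (simp add: in_free_algebra)

lemma edge_ghost_action:
  "word_action gen_action [Edge e, Ghost e] s = (if \<exists>t. edge_action e t = Some s then Some s else None)"
proof (cases "\<exists>t. edge_action e t = Some s")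
  case True
  then obtain t where "edge_action e t = Some s" by blast
  moreover from this have "gen_action (Ghost e) s = Some t" by (simp only: ghost_action_iff)
  ultimately show ?thesis by auto
next
  case False
  then have "gen_action (Ghost e) s = None"
    using ghost_action_iff by (metis not_None_eq)
  then show ?thesis using False by simp
qed

text \<open>
  The last relation is where saturation is needed: a regular vertex outside \<open>H\<close> still has an arc that
  leads outside \<open>H\<close>, so every basis vector over it is in the range of exactly one arc.
\<close>

lemma relations_in_kernel: "lpa_relations G \<subseteq> (kernel :: (_ \<Rightarrow>\<^sub>0 'k::field) set)"
proof
  note pair = generator_eq_mon mon_append[symmetric] append.simps
  fix r :: "_ \<Rightarrow>\<^sub>0 'k" assume "r \<in> lpa_relations G"
  then show "r \<in> kernel"
  proof cases
    case (vertex_idem v)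
    then show ?thesis unfolding pair
      by (auto intro!: diff_in_action_kernel mon_carrier simp: lpa_gens_iff)
  next
    case (vertex_orth v w)
    then show ?thesis unfolding pair
      by (simp, subst mon_in_action_kernel) (auto intro!: mon_carrier simp: lpa_gens_iff)
  next
    case (source_edge e)
    have "word_action gen_action [Vertex (tail G e), Edge e] s = word_action gen_action [Edge e] s" for s
      using source_edge(2) edge_action_SomeD by (cases "edge_action e s") auto
    then show ?thesis unfolding pair source_edge(1)
      using source_edge(2) by (intro diff_in_action_kernel mon_carrier) (auto simp: lpa_gens_iff)
  next
    case (edge_range e)
    have "word_action gen_action [Edge e, Vertex (head G e)] s = word_action gen_action [Edge e] s" for s
      using edge_range(2) by (cases s) (auto simp: edge_action.simps)
    then show ?thesis unfolding pair edge_range(1)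
      using edge_range(2) by (intro diff_in_action_kernel mon_carrier) (auto simp: lpa_gens_iff)
  next
    case (range_ghost e)
    have "word_action gen_action [Vertex (head G e), Ghost e] s = word_action gen_action [Ghost e] s" for s
    proof (cases "gen_action (Ghost e) s")
      case (Some t)
      then have "edge_action e t = Some s" by (simp only: ghost_action_iff)
      from edge_action_SomeD[OF this] show ?thesis using range_ghost(2) Some by simp
    qed simp
    then show ?thesis unfolding pair range_ghost(1)
      using range_ghost(2) by (intro diff_in_action_kernel mon_carrier) (auto simp: lpa_gens_iff)
  next
    case (ghost_source e)
    have "word_action gen_action [Ghost e, Vertex (tail G e)] s = word_action gen_action [Ghost e] s" for s
    proof (cases "gen_action (Ghost e) s")
      case (Some t)
      then have "edge_action e t = Some s" by (simp only: ghost_action_iff)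
      from edge_action_SomeD[OF this] show ?thesis using ghost_source(2) Some by simp
    qed simp
    then show ?thesis unfolding pair ghost_source(1)
      using ghost_source(2) by (intro diff_in_action_kernel mon_carrier) (auto simp: lpa_gens_iff)
  next
    case (CK1_eq e)
    have "word_action gen_action [Ghost e, Edge e] s = word_action gen_action [Vertex (head G e)] s" for s
    proof (cases "edge_action e s")
      case None
      then show ?thesis using CK1_eq(2) by (cases s) (auto simp: edge_action.simps split: if_splits)
    next
      case (Some r)
      then have "gen_action (Ghost e) r = Some s" by (simp only: ghost_action_iff)
      with edge_action_SomeD[OF Some] show ?thesis using CK1_eq(2) Some by simp
    qed
    then show ?thesis unfolding pair CK1_eq(1)
      using CK1_eq(2) by (intro diff_in_action_kernel mon_carrier) (auto simp: lpa_gens_iff)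
  next
    case (CK1_neq e f)
    have "word_action gen_action [Ghost e, Edge f] s = None" for s
    proof (cases "word_action gen_action [Ghost e, Edge f] s")
      case (Some t)
      then obtain r where "edge_action f s = Some r" "edge_action e t = Some r"
        by (auto simp: ghost_action_iff split: Option.bind_splits)
      then show ?thesis using edge_action_inj CK1_neq by blast
    qed
    then show ?thesis unfolding pair CK1_neq(1)
      using CK1_neq by (subst mon_in_action_kernel) (auto intro!: mon_carrier simp: lpa_gens_iff)
  next
    case (CK2 v)
    then have v: "v \<in> verts G" "finite (out_arcs G v)" by (auto simp: regular_vertex_def)
    have entry: "matrix_entry gen_action s t [Vertex v] =
        (\<Sum>e\<in>out_arcs G v. matrix_entry gen_action s t [Edge e, Ghost e] :: 'k)" for s t
    proof -
      obtain u d n where s: "s = (u, d, n)" by (cases s)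
      show ?thesis
      proof (cases "u = v \<and> v \<notin> H")
        case False
        have no: "edge_action e r \<noteq> Some s" if "e \<in> out_arcs G v" for e r
          using False that edge_action_SomeD[of e r s] s by auto
        have "matrix_entry gen_action s t [Edge e, Ghost e] = (0 :: 'k)" if "e \<in> out_arcs G v" for e
          unfolding matrix_entry_def edge_ghost_action using no[OF that] by simp
        then show ?thesis using False by (auto simp: matrix_entry_def s)
      next
        case True
        have "\<not> head G ` out_arcs G v \<subseteq> H"
          using saturated CK2(2) True by (auto simp: saturated_def)
        then have "live_arcs v \<noteq> {}" by (auto simp: live_arcs_def)
        then obtain e r where e: "e \<in> out_arcs G v" "edge_action e r = Some s"
          using edge_action_range[of v d n] True v(1) unfolding s by blast
        have "(\<exists>r. edge_action f r = Some s) \<longleftrightarrow> f = e" for f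
          using e edge_action_inj by blast
        then have "matrix_entry gen_action s t [Edge f, Ghost f] = (if f = e then if s = t then 1 else 0 else 0 :: 'k)" for f
          unfolding matrix_entry_def edge_ghost_action by auto
        moreover have "matrix_entry gen_action s t [Vertex v] = (if s = t then 1 else 0 :: 'k)"
          using True v(1) by (auto simp: matrix_entry_def s)
        ultimately show ?thesis using v(2) e(1) by simp
      qed
    qed
    have "(mon [Vertex v] - (\<Sum>e\<in>out_arcs G v. mon [Edge e, Ghost e]) :: _ \<Rightarrow>\<^sub>0 'k)
        \<in> Carrier (free_algebra (lpa_gens G))"
      using v by (intro free_algebra_diff free_algebra_sum mon_carrier) (auto simp: lpa_gens_iff)
    then show ?thesis unfolding CK2(1) pair generator_eq_mon
      by (simp add: action_kernel_def lin_form_diff lin_form_sum entry)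
  qed
qed

lemma algebra_ideal_kernel: "algebra_ideal (free_algebra (lpa_gens G)) (kernel :: (_ \<Rightarrow>\<^sub>0 'k::field) set)"
  by (rule algebra_ideal_action_kernel) (rule gen_action_inj)

lemma vertex_in_kernel_iff:
  assumes "v \<in> verts G"
  shows "(mon [Vertex v] :: _ \<Rightarrow>\<^sub>0 'k::field) \<in> kernel \<longleftrightarrow> v \<in> H"
  using assms by (subst mon_in_action_kernel) (auto intro!: mon_carrier simp: lpa_gens_iff split_paired_All split: if_splits)

text \<open>
  Each arc on the walk is the only one at its source, so \<open>index\<close> does not change the last
  coordinate.
\<close>

lemma exitless_walk_action:
  assumes "awalk u p w" "w \<notin> H" "\<And>e. e \<in> set p \<Longrightarrow> out_arcs G (tail G e) = {e}"
  shows "word_action gen_action (map Edge p) (w, d, n) = Some (u, d + \<delta> * int (length p), n) \<and> u \<notin> H"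
  using assms
proof (induction p arbitrary: u)
  case Nil
  then show ?case by (simp add: awalk_simps)
next
  case (Cons e p)
  have e: "e \<in> arcs G" "tail G e = u" "awalk (head G e) p w"
    using Cons.prems(1) by (auto simp: awalk_simps)
  have IH: "word_action gen_action (map Edge p) (w, d, n) = Some (head G e, d + \<delta> * int (length p), n)"
    "head G e \<notin> H"
    using Cons e(3) by auto
  have "live_arcs u = {e}"
    using Cons.prems(3)[of e] e IH(2) by (auto simp: live_arcs_def)
  then have "index u = snd" by (auto simp: index_def)
  moreover have "u \<notin> H" using hereditary e(1,2) IH(2) by (auto simp: hereditary_def)
  ultimately show ?case using e(1,2) IH by (simp add: edge_action.simps algebra_simps)
qed

lemma exitless_closed_walk_in_kernel_iff:
  assumes "awalk v p v" "p \<noteq> []" "v \<notin> H" "\<And>e. e \<in> set p \<Longrightarrow> out_arcs G (tail G e) = {e}"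
  shows "(mon (map Edge p) - mon [Vertex v] :: _ \<Rightarrow>\<^sub>0 'k::field) \<in> kernel \<longleftrightarrow> \<delta> = 0"
proof
  have v: "v \<in> verts G" using assms(1) by (auto dest: awalk_hd_in_verts)
  note walk = exitless_walk_action[OF assms(1,3,4), THEN conjunct1]
  have arcs: "set p \<subseteq> arcs G" using assms(1) by (auto dest: awalk_arcs)
  {
    assume "(mon (map Edge p) - mon [Vertex v] :: _ \<Rightarrow>\<^sub>0 'k) \<in> kernel"
    then have "matrix_entry gen_action (v, 0, 0) (v, 0, 0) (map Edge p) =
        (matrix_entry gen_action (v, 0, 0) (v, 0, 0) [Vertex v] :: 'k)"
      by (simp add: action_kernel_def lin_form_diff)
    then show "\<delta> = 0" using walk[of 0 0] v assms(2,3) by (simp add: matrix_entry_def split: if_splits)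
  next
    assume \<delta>: "\<delta> = 0"
    have "word_action gen_action (map Edge p) s = word_action gen_action [Vertex v] s" for s
    proof (cases s)
      case (fields u d n)
      show ?thesis
      proof (cases "u = v")
        case True
        have "d + \<delta> * int (length p) = d" using \<delta> by simp
        then show ?thesis using walk[of d n] True v assms(3) by (simp add: fields)
      next
        case False
        obtain e p' where p: "p = p' @ [e]" using assms(2) by (metis rev_exhaust)
        then have "head G e = v" using assms(1) by (auto simp: awalk_simps)
        then show ?thesis using False by (simp add: fields p word_action_append edge_action.simps)
      qed
    qed
    then show "(mon (map Edge p) - mon [Vertex v] :: _ \<Rightarrow>\<^sub>0 'k) \<in> kernel"
      using v arcs assms(2) by (intro diff_in_action_kernel mon_carrier) (auto simp: lpa_gens_iff)
  }
qed

end

section \<open>The simplicity criterion\<close>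

theorem theorem6p18:
  fixes E :: "('v, 'e) pre_digraph"
  assumes "wf_digraph E"
    and "countable (verts E)"
    and "countable (arcs E)"
  shows "simple_algebra (leavitt_path_algebra TYPE('k::field) E) \<longleftrightarrow>
    (\<forall>H. hereditary E H \<and> saturated E H \<longrightarrow> H = {} \<or> H = verts E) \<and>
    condition_L E"
proof -
  interpret wf_digraph E by fact
  let ?F = "free_algebra (lpa_gens E) :: ('k, _) algebra"
  define R where "R = ideal_generated ?F (lpa_relations E)"
  have ideal: "algebra_ideal ?F R"
    unfolding R_def by (intro algebra_ideal_generated k_algebra_free lpa_relations_subset assms)
  have least: "R \<subseteq> J" if "algebra_ideal ?F J" "lpa_relations E \<subseteq> J" for J
    using that unfolding R_def ideal_generated_def by blast
  have "lpa_relations E \<subseteq> R"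
    unfolding R_def ideal_generated_def by blast
  then interpret lpa_ideal E R
    by unfold_locales (rule ideal)
  have simple_iff: "simple_algebra (leavitt_path_algebra TYPE('k) E) \<longleftrightarrow>
      (\<forall>J. algebra_ideal ?F J \<and> R \<subseteq> J \<longrightarrow> J = R \<or> J = Carrier ?F)"
    unfolding leavitt_path_algebra_def R_def[symmetric]
    by (rule simple_quotient_iff[OF k_algebra_free ideal])
  have branching: "branching E H" if "hereditary E H" "saturated E H" for H
    using that assms(3) by unfold_locales
  have empty: "hereditary E {}" "saturated E {}"
    by (auto simp: hereditary_def saturated_def regular_vertex_def)
  define \<K> where "\<K> H \<delta> = (action_kernel (lpa_gens E) (branching.gen_action E H \<delta>) :: (_ \<Rightarrow>\<^sub>0 'k) set)"
    for H \<delta>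
  have R_sub: "R \<subseteq> \<K> H \<delta>" if "hereditary E H" "saturated E H" for H \<delta>
    unfolding \<K>_def using branching[OF that]
    by (intro least branching.algebra_ideal_kernel branching.relations_in_kernel)
  show ?thesis
  proof (intro iffI conjI allI impI)
    assume simple: "simple_algebra (leavitt_path_algebra TYPE('k) E)"
    \<comment> \<open>A kernel misses all vertices outside \<open>H\<close>, so simplicity leaves only \<open>R\<close> for it.\<close>
    have kernel_eq: "\<K> H \<delta> = R" if "hereditary E H" "saturated E H" "v \<in> verts E" "v \<notin> H" for H \<delta> v
    proof -
      note B = branching[OF that(1,2)]
      have "mon [Vertex v] \<notin> \<K> H \<delta>" "mon [Vertex v] \<in> Carrier ?F"
        unfolding \<K>_def using branching.vertex_in_kernel_iff[OF B that(3)] that(3,4)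
        by (auto simp: in_free_algebra)
      then have "\<K> H \<delta> \<noteq> Carrier ?F" by blast
      then show ?thesis
        using simple R_sub[OF that(1,2)] branching.algebra_ideal_kernel[OF B]
        unfolding simple_iff \<K>_def by blast
    qed
    {
      fix H assume H: "hereditary E H \<and> saturated E H"
      show "H = {} \<or> H = verts E"
      proof (rule ccontr)
        assume "\<not> (H = {} \<or> H = verts E)"
        moreover have "H \<subseteq> verts E" using H by (simp add: hereditary_def)
        ultimately obtain u v where u: "u \<in> H" "u \<in> verts E" and v: "v \<in> verts E" "v \<notin> H" by blast
        \<comment> \<open>A vertex in \<open>H\<close> would be in the kernel for \<open>H\<close>, which is also the kernel for \<open>{}\<close>.\<close>
        have "mon [Vertex u] \<in> \<K> H 0"
          unfolding \<K>_def using branching.vertex_in_kernel_iff[OF branching u(2)] H u(1) by blast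
        also have "\<dots> \<subseteq> \<K> {} 0"
          using kernel_eq H v R_sub[OF empty] by metis
        finally show False
          unfolding \<K>_def using branching.vertex_in_kernel_iff[OF branching[OF empty] u(2)] by blast
      qed
    next
      show "condition_L E"
        unfolding condition_L_def
      proof (intro allI impI, rule ccontr)
        fix p assume p: "closed_w p" and no_exit: "\<nexists>f. is_exit E p f"
        then obtain v where v: "awalk v p v" "p \<noteq> []" by (auto simp: closed_w_def)
        have exitless: "out_arcs E (tail E e) = {e}" if e: "e \<in> set p" for e
        proof -
          obtain i where "i < length p" "p ! i = e" using e by (auto simp: in_set_conv_nth)
          then have "f = e" if "f \<in> out_arcs E (tail E e)" for f
            using that no_exit by (auto simp: is_exit_def)
          then show ?thesis using awalk_arcs[OF v(1) e] by auto
        qed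
        have iff: "mon (map Edge p) - mon [Vertex v] \<in> \<K> {} \<delta> \<longleftrightarrow> \<delta> = 0" for \<delta>
          unfolding \<K>_def
          using branching.exitless_closed_walk_in_kernel_iff[OF branching[OF empty] v _ exitless] by blast
        have "\<K> {} \<delta> = R" for \<delta>
          using kernel_eq[OF empty, of v] v(1) by (auto dest: awalk_hd_in_verts)
        then show False using iff[of 0] iff[of 1] by simp
      qed
    }
  next
    assume graph: "(\<forall>H. hereditary E H \<and> saturated E H \<longrightarrow> H = {} \<or> H = verts E) \<and> condition_L E"
    show "simple_algebra (leavitt_path_algebra TYPE('k) E)"
      unfolding simple_iff using graph larger_ideal_eq_carrier by blast
  qed
qed

end
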